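(* Let $p$ be an odd prime not dividing $M$ (the least positive common denominator of the hypergeometric datum concerned) and fix $\lambda \in \mathbb{F}_p^{\times}$. Let $f_{\lambda}(x) = x^{3} + 3x^{2} - 4\lambda$ and let $N_{f}(\lambda,p)$ be the number of zeros of $f_{\lambda}(x)$ in $\mathbb{F}_p^{\times}$, counted with multiplicity. Let $\phi$ be the quadratic character of $\mathbb{F}_p$ (with $\phi(0)=0$). If $p>3$, then $$(1)\quad H_{p}\left(\left\{\tfrac14,\tfrac34\right\},\left\{1,\tfrac12\right\};\lambda\right) = \left(\frac{1 + \phi(\lambda)}{2} \right) \left[\phi(1 + \sqrt{\lambda}) + \phi(1 - \sqrt{\lambda}) \right],$$ where $\sqrt{\lambda}$ is a square root of $\lambda$ in $\mathbb{F}_p$ if $\phi(\lambda)=1$, and the right side is read as $0$ if $\phi(\lambda)=-1$; $$(2)\quad H_{p}\left(\left\{\tfrac13,\tfrac23\right\},\left\{1,\tfrac12\right\};\lambda\right) = N_{f}(\lambda,p) - 1;$$ $$(3)\quad H_{p}\left(\left\{\tfrac16,\tfrac56\right\},\left\{1,\tfrac12\right\};\lambda\right) = \phi\left(\frac{\lambda}{3}\right)\left(N_{f}(\lambda,p) - 1\right).$$ In particular, $$H_{p}\left(\left\{\tfrac14,\tfrac34\right\},\left\{1,\tfrac12\right\};1\right)=\phi(2),\quad H_{p}\left(\left\{\tfrac13,\tfrac23\right\},\left\{1,\tfrac12\right\};1\right)=1,\quad H_{p}\left(\left\{\tfrac16,\tfrac56\right\},\left\{1,\tfrac12\right\};1\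right)=\phi(3).$$
   Context: Finite hypergeometric function. Let $p$ be an odd prime, $\zeta_p$ a fixed primitive $p$th root of unity, $\omega$ a generator of the group of multiplicative characters $\widehat{\mathbb{F}_p^\times}$, with the convention $\chi(0)=0$ for every multiplicative character $\chi$. The Gauss sum is $g(\chi)=\sum_{x\in\mathbb{F}_p^\times}\chi(x)\zeta_p^{x}$. Let $\alpha=\{a_1,\dots,a_n\}$, $\beta=\{1,b_2,\dots,b_n\}$ (put $b_1=1$) be multisets of rationals such that $a_i-b_j\notin\mathbb{Z}$ for all $i,j$ and such that $\prod_j(X-e^{2\pi i a_j})$ and $\prod_j(X-e^{2\pi i b_j})$ lie in $\mathbb{Z}[X]$. Let $M$ be the least positive common denominator of the elements of $\alpha\cup\beta$, and suppose $p\nmid M$. If $p\equiv 1\pmod M$, then for $\lambda\in\mathbb{F}_p^\times$ $$H_p(\alpha,\beta;\lambda)=\frac{1}{1-p}\sum_{k=0}^{p-2}\prod_{i=1}^n\frac{g(\omega^{k+(p-1)a_i})\,g(\omega^{-k-(p-1)b_i})}{g(\omega^{(p-1)a_i})\,g(\omega^{-(p-1)b_i})}\,\omega^k((-1)^n\lambda).$$ For all odd primes $p\nmid M$ the function is defined by the following extension (Beukers–Cohen–Mellit), which agrees with the formula above when $p\equiv1\pmod M$. Write $$\prod_{j=1}^n\frac{X-e^{2\pi i a_j}}{X-e^{2\pi i b_j}}=\frac{\prod_{i=1}^r(X^{u_i}-1)}{\prod_{j=1}^t(X^{v_j}-1)}$$ with positive integers $u_i,v_j$ satisfying $u_i\ne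 v_j$ for all $i,j$; let $D(X)$ be the gcd of $\prod_i(X^{u_i}-1)$ and $\prod_j(X^{v_j}-1)$, let $s(k)$ be the multiplicity of $e^{2\pi i k/(p-1)}$ as a zero of $D$, and let $N=\prod_i u_i^{u_i}/\prod_j v_j^{v_j}$. Then $$H_p(\alpha,\beta;\lambda)=\frac{(-1)^{r+t}}{1-p}\sum_{k=0}^{p-2}p^{-s(0)+s(k)}\prod_{i=1}^r g(\omega^{u_ik})\prod_{j=1}^t g(\omega^{-v_jk})\;\omega^k\!\left((-1)^{v_1+\cdots+v_t}N^{-1}\lambda\right).$$
   Formalization: At λ=1, f=(x-1)(x+2)^2 has 3 zeros with multiplicity, so (2), (3) as printed contradict the special values; (2), (3) are proved with multiplicity for λ≠1 and with distinct zeros for all λ≠0. *)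

theory Defs
  imports
    Complex_Main
    "HOL-Library.Multiset"
    "HOL-Computational_Algebra.Computational_Algebra"
    "HOL-Computational_Algebra.Field_as_Ring"
    "HOL-Number_Theory.Residues"
    "Berlekamp_Zassenhaus.Finite_Field"
begin

text \<open>
  The field with \<open>p\<close> elements is \<^typ>\<open>'p::prime_card mod_ring\<close>, where \<open>p = CARD('p)\<close>.
\<close>

subsection \<open>Characters and Gauss sums\<close>

definition primitive_root_unity :: "nat \<Rightarrow> complex \<Rightarrow> bool" where
  "primitive_root_unity n z \<longleftrightarrow> n > 0 \<and> z ^ n = 1 \<and> (\<forall>m. 0 < m \<and> m < n \<longrightarrow> z ^ m \<noteq> 1)"

definition mult_character :: "('p::prime_card mod_ring \<Rightarrow> complex) \<Rightarrow> bool" where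
  "mult_character \<chi> \<longleftrightarrow> \<chi> 0 = 0 \<and> \<chi> 1 = 1 \<and> (\<forall>x y. \<chi> (x * y) = \<chi> x * \<chi> y)"

text \<open>
  The convention \<open>\<chi>(0) = 0\<close> includes the trivial character, so \<open>\<omega>\<^sup>0\<close> also vanishes at \<open>0\<close>
  (whereas \<open>0 powi 0 = 1\<close>).
\<close>

definition char_power ::
  "('p::prime_card mod_ring \<Rightarrow> complex) \<Rightarrow> int \<Rightarrow> 'p mod_ring \<Rightarrow> complex" where
  "char_power \<omega> k x = (if x = 0 then 0 else \<omega> x powi k)"

definition generates_characters :: "('p::prime_card mod_ring \<Rightarrow> complex) \<Rightarrow> bool" where
  "generates_characters \<omega> \<longleftrightarrow>
     mult_character \<omega> \<and> (\<forall>\<chi>. mult_character \<chi> \<longrightarrow> (\<exists>k::int. \<chi> = char_power \<omega> k))"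

definition quad_char :: "'p::prime_card mod_ring \<Rightarrow> complex" where
  "quad_char x = of_int (Legendre (to_int_mod_ring x) (int CARD('p)))"

definition gauss_sum :: "complex \<Rightarrow> ('p::prime_card mod_ring \<Rightarrow> complex) \<Rightarrow> complex" where
  "gauss_sum \<zeta> \<chi> = (\<Sum>x \<in> UNIV - {0}. \<chi> x * \<zeta> powi to_int_mod_ring x)"

subsection \<open>The finite hypergeometric function\<close>

definition common_denom :: "rat multiset \<Rightarrow> rat multiset \<Rightarrow> nat" where
  "common_denom \<alpha> \<beta> = (LEAST m. 0 < m \<and> (\<forall>x \<in># \<alpha> + \<beta>. of_nat m * x \<in> \<int>))"

definition param_poly :: "rat multiset \<Rightarrow> complex poly" where
  "param_poly \<alpha> = (\<Prod>a \<in># \<alpha>. [:- cis (2 * pi * of_rat a), 1:])"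

definition power_poly :: "nat multiset \<Rightarrow> complex poly" where
  "power_poly U = (\<Prod>u \<in># U. Polynomial.monom 1 u - 1)"

definition is_exponents ::
  "rat multiset \<Rightarrow> rat multiset \<Rightarrow> nat multiset \<Rightarrow> nat multiset \<Rightarrow> bool" where
  "is_exponents \<alpha> \<beta> U V \<longleftrightarrow>
     0 \<notin># U \<and> 0 \<notin># V \<and> set_mset U \<inter> set_mset V = {} \<and>
     Fract (param_poly \<alpha>) (param_poly \<beta>) = Fract (power_poly U) (power_poly V)"

text \<open>
  For data \<open>\<alpha>, \<beta>\<close> defined over the rationals there is exactly one such pair of multisets.
\<close>

definition exponents :: "rat multiset \<Rightarrow> rat multiset \<Rightarrow> nat multiset \<times> nat multiset" where
  "exponents \<alpha> \<beta> = (THE UV. is_exponents \<alpha> \<beta> (fst UV) (snd UV))"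

text \<open>The multiplicity of \<open>exp (2 \<pi> i k / (p - 1))\<close> as a zero of the greatest common divisor.\<close>

definition gcd_mult :: "nat \<Rightarrow> nat multiset \<Rightarrow> nat multiset \<Rightarrow> int \<Rightarrow> nat" where
  "gcd_mult p U V k =
     Polynomial.order (cis (2 * pi * of_int k / (of_nat p - 1))) (gcd (power_poly U) (power_poly V))"

text \<open>
  The image in \<open>F\<^sub>p\<close> of the rational number \<open>N\<close>. It is meaningful because the exponents divide the
  common denominator of the data, so \<open>p\<close> divides none of them.
\<close>

definition exponents_norm :: "nat multiset \<Rightarrow> nat multiset \<Rightarrow> 'p::prime_card mod_ring" where
  "exponents_norm U V = of_nat (\<Prod>u \<in># U. u ^ u) / of_nat (\<Prod>v \<in># V. v ^ v)"

text \<open>The definition of Beukers, Cohen and Mellit.\<close>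

definition hyp_H ::
  "complex \<Rightarrow> ('p::prime_card mod_ring \<Rightarrow> complex) \<Rightarrow> rat multiset \<Rightarrow> rat multiset \<Rightarrow>
   'p mod_ring \<Rightarrow> complex" where
  "hyp_H \<zeta> \<omega> \<alpha> \<beta> t =
    (let p = CARD('p); (U, V) = exponents \<alpha> \<beta> in
      (- 1) ^ (size U + size V) / (1 - of_nat p) *
      (\<Sum>k = 0..int p - 2.
         of_nat p powi (- int (gcd_mult p U V 0) + int (gcd_mult p U V k)) *
         (\<Prod>u \<in># U. gauss_sum \<zeta> (char_power \<omega> (int u * k))) *
         (\<Prod>v \<in># V. gauss_sum \<zeta> (char_power \<omega> (- int v * k))) *
         char_power \<omega> k ((- 1) ^ (sum_mset V) * inverse (exponents_norm U V) * t)))"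

subsection \<open>The cubic\<close>

definition cubic :: "'p::prime_card mod_ring \<Rightarrow> 'p mod_ring poly" where
  "cubic t = [:- 4 * t, 0, 3, 1:]"

text \<open>
  The numbers of nonzero zeros, with and without multiplicity. For nonzero \<open>t\<close> and \<open>p > 3\<close> they
  differ only at \<open>t = 1\<close>, where the cubic is \<open>(x - 1) (x + 2)\<^sup>2\<close>.
\<close>

definition zeros_with_mult :: "'p::prime_card mod_ring poly \<Rightarrow> nat" where
  "zeros_with_mult f = (\<Sum>x | x \<noteq> 0 \<and> poly f x = 0. Polynomial.order x f)"

definition zeros_distinct :: "'p::prime_card mod_ring poly \<Rightarrow> nat" where
  "zeros_distinct f = card {x. x \<noteq> 0 \<and> poly f x = 0}"

end

theory Submission
  imports Defs "HOL-Number_Theory.Residue_Primitive_Roots"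
begin

text \<open>
  The exponents are \<open>{4}, {2, 2}\<close> for \<open>1/4, 3/4\<close>, then \<open>{3}, {1, 2}\<close> for \<open>1/3, 2/3\<close>, and
  \<open>{6, 1}, {2, 2, 3}\<close> for \<open>1/6, 5/6\<close>. In the first two cases the summand is a product
  \<open>g(\<omega>\<^bsup>(b+c)k\<^esup>) g(\<omega>\<^bsup>-bk\<^esup>) g(\<omega>\<^bsup>-ck\<^esup>)\<close>; since \<open>b + c\<close> matches the two negative exponents, scaling out one
  variable and orthogonality of characters turn the sum over \<open>k\<close> into the number of \<open>y, z\<close> with
  \<open>y\<^sup>b z\<^sup>c\<close> prescribed and \<open>1 + y + z = 0\<close>. The corrections by powers of \<open>p\<close> at the trivial and
  quadratic characters cancel the remaining terms.

  In the third case the Hasse-Davenport relation for the quadratic character \<open>\<phi>\<close>, applied to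
  \<open>g(\<omega>\<^bsup>6k\<^esup>)\<close> and to one factor \<open>g(\<omega>\<^bsup>-2k\<^esup>)\<close>, identifies the \<open>k\<close>-th summand with \<open>\<phi>(t/3)\<close> times the
  summand of the second case at \<open>k + (p - 1)/2\<close>.
\<close>

subsection \<open>Exponents of the hypergeometric data\<close>

lemma poly_power_poly: "poly (power_poly U) z = (\<Prod>u\<in>#U. z ^ u - 1)"
  by (induction U) (simp_all add: power_poly_def poly_monom)

lemma power_poly_empty [simp]: "power_poly {#} = 1"
  by (simp add: power_poly_def)

lemma power_poly_add_mset [simp]:
  "power_poly (add_mset u U) = (Polynomial.monom 1 u - 1) * power_poly U"
  by (simp add: power_poly_def)

lemma monom_minus_1_neq_0: "u > 0 \<Longrightarrow> Polynomial.monom 1 u - 1 \<noteq> (0 :: complex poly)"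
  by (metis degree_1 degree_monom_eq eq_iff_diff_eq_0 less_numeral_extra(3) zero_neq_one)

lemma power_poly_neq_0: "0 \<notin># U \<Longrightarrow> power_poly U \<noteq> 0"
  using monom_minus_1_neq_0 by (induction U) force+

lemma power_poly_plus: "power_poly (U + V) = power_poly U * power_poly V"
  by (simp add: power_poly_def)

lemma cis_2pi_eq_1_iff: "cis (2 * pi * r) = 1 \<longleftrightarrow> r \<in> \<int>"
proof
  assume "cis (2 * pi * r) = 1"
  then have "cos (2 * pi * r) = 1"
    by (simp add: complex_eq_iff)
  then obtain x :: int where "2 * pi * r = of_int x * 2 * pi"
    using cos_one_2pi_int by blast
  then show "r \<in> \<int>" by simp
qed simp

text \<open>Serves both the primitive \<open>m\<close>-th roots that separate multisets of exponents
  and the points \<open>exp (2 pi i k / (p - 1))\<close> at which \<open>gcd_mult\<close> is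
  taken.\<close>

lemma cis_power_eq_1_iff:
  assumes "m > 0"
  shows "cis (2 * pi * of_int k / of_nat m) ^ u = 1 \<longleftrightarrow> int m dvd int u * k"
proof -
  have "cis (2 * pi * of_int k / of_nat m) ^ u = cis (2 * pi * (of_int (int u * k) / of_nat m))"
    by (simp add: DeMoivre mult_ac)
  also have "\<dots> = 1 \<longleftrightarrow> (\<exists>x::int. of_int (int u * k) / of_nat m = (of_int x :: real))"
    unfolding cis_2pi_eq_1_iff by (auto elim: Ints_cases)
  also have "\<dots> \<longleftrightarrow> (\<exists>x::int. int u * k = int m * x)"
  proof (intro ex_cong1)
    fix x :: int
    have "of_int (int u * k) / of_nat m = (of_int x :: real) \<longleftrightarrow>
            (of_int (int u * k) :: real) = of_int (int m * x)"
      using assms by (simp add: field_simps)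
    also have "\<dots> \<longleftrightarrow> int u * k = int m * x"
      by (rule of_int_eq_iff)
    finally show "of_int (int u * k) / of_nat m = (of_int x :: real) \<longleftrightarrow> int u * k = int m * x" .
  qed
  finally show ?thesis by (simp add: dvd_def)
qed

text \<open>
  The largest exponent \<open>m\<close> in a multiset is read off from the zeros: a primitive \<open>m\<close>-th root
  of unity is a zero only if some exponent is a multiple of \<open>m\<close>.
\<close>

lemma power_poly_inject:
  assumes "0 \<notin># A" "0 \<notin># B" "power_poly A = power_poly B"
  shows "A = B"
  using assms
proof (induction "size A + size B" arbitrary: A B rule: less_induct)
  case less
  show ?case
  proof (cases "A = {#} \<and> B = {#}")
    case False
    define m where "m = Max (set_mset A \<union> set_mset B)"
    have m_in: "m \<in> set_mset A \<union> set_mset B"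
      unfolding m_def using False by (intro Max_in) auto
    have m_max: "u \<le> m" if "u \<in> set_mset A \<union> set_mset B" for u
      unfolding m_def using that by (intro Max_ge) auto
    have "m > 0"
      using m_in less.prems(1,2) by (metis Un_iff neq0_conv)
    define z where "z = cis (2 * pi * of_int 1 / of_nat m)"
    have root_iff: "poly (power_poly C) z = 0 \<longleftrightarrow> m \<in># C"
      if "0 \<notin># C" "set_mset C \<subseteq> set_mset A \<union> set_mset B" for C
    proof -
      have "z ^ u - 1 = 0 \<longleftrightarrow> m dvd u" for u
        unfolding z_def using cis_power_eq_1_iff[OF \<open>m > 0\<close>, of 1 u] by simp
      then have "poly (power_poly C) z = 0 \<longleftrightarrow> (\<exists>u\<in>#C. m dvd u)"
        unfolding poly_power_poly prod_mset_zero_iff set_image_mset image_iff by metis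
      also have "\<dots> \<longleftrightarrow> m \<in># C"
      proof safe
        fix u assume u: "u \<in># C" "m dvd u"
        have "u \<noteq> 0"
          using u(1) that(1) by metis
        moreover have "u \<le> m"
          using u(1) that(2) by (intro m_max) (rule subsetD)
        ultimately have "u = m"
          using dvd_imp_le[OF u(2)] by simp
        then show "m \<in># C"
          using u by simp
      next
        assume "m \<in># C"
        then show "\<exists>u\<in>#C. m dvd u" by (meson dvd_refl)
      qed
      finally show ?thesis .
    qed
    have "m \<in># A \<longleftrightarrow> m \<in># B"
      unfolding root_iff[OF less.prems(1) Un_upper1, symmetric]
        root_iff[OF less.prems(2) Un_upper2, symmetric] less.prems(3) ..
    with m_in have "m \<in># A" "m \<in># B"
      by simp_all
    then obtain A' B' where AB: "A = add_mset m A'" "B = add_mset m B'"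
      using multi_member_split by metis
    have "power_poly A' = power_poly B'"
      using less.prems(3) monom_minus_1_neq_0[OF \<open>m > 0\<close>] by (simp add: AB)
    then have "A' = B'"
      using less.hyps[of A' B'] less.prems by (simp add: AB)
    then show ?thesis by (simp add: AB)
  qed auto
qed

lemma param_poly_neq_0: "param_poly \<alpha> \<noteq> 0"
  by (simp add: param_poly_def image_iff)

text \<open>The definite description needs uniqueness: cross-multiplying two representations gives
  \<open>U' + V = U + V'\<close> by injectivity of \<open>power_poly\<close>, and disjointness of
  numerator and denominator exponents then separates the two parts.\<close>

lemma exponents_eqI:
  assumes "0 \<notin># U" "0 \<notin># V" "set_mset U \<inter> set_mset V = {}"
    and "param_poly \<alpha> * power_poly V = power_poly U * param_poly \<beta>"
  shows "exponents \<alpha> \<beta> = (U, V)"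
proof -
  have exps: "is_exponents \<alpha> \<beta> U V"
    using assms by (simp add: is_exponents_def eq_fract param_poly_neq_0 power_poly_neq_0)
  have unique: "U' = U \<and> V' = V" if "is_exponents \<alpha> \<beta> U' V'" for U' V'
  proof -
    have *: "0 \<notin># U'" "0 \<notin># V'" "set_mset U' \<inter> set_mset V' = {}"
      using that unfolding is_exponents_def by blast+
    have "Fract (power_poly U') (power_poly V') = Fract (power_poly U) (power_poly V)"
      using that exps by (simp add: is_exponents_def)
    then have "power_poly (U' + V) = power_poly (U + V')"
      using *(1,2) assms(1,2) by (simp add: eq_fract power_poly_neq_0 power_poly_plus)
    then have sum_eq: "U' + V = U + V'"
      using *(1,2) assms(1,2) by (intro power_poly_inject) simp_all
    have "count U' x = count U x \<and> count V' x = count V x" for x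
    proof -
      have "count U' x + count V x = count U x + count V' x"
        using arg_cong[OF sum_eq, of "\<lambda>M. count M x"] by simp
      moreover have "count U x = 0 \<or> count V x = 0" "count U' x = 0 \<or> count V' x = 0"
        using *(3) assms(3) unfolding count_eq_zero_iff by blast+
      ultimately show ?thesis by auto
    qed
    then show ?thesis by (simp add: multiset_eq_iff)
  qed
  show ?thesis
    unfolding exponents_def
  proof (rule the_equality)
    show "is_exponents \<alpha> \<beta> (fst (U, V)) (snd (U, V))"
      using exps by simp
  next
    fix UV assume "is_exponents \<alpha> \<beta> (fst UV) (snd UV)"
    then show "UV = (U, V)"
      using unique by (metis prod.collapse)
  qed
qed

section \<open>Multiplicities of zeros of the gcd\<close>

lemma order_gcd:
  fixes f g :: "'a :: field_gcd poly"
  assumes "f \<noteq> 0" "g \<noteq> 0"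
  shows "Polynomial.order z (gcd f g) = min (Polynomial.order z f) (Polynomial.order z g)"
proof -
  have "n \<le> Polynomial.order z (gcd f g) \<longleftrightarrow> n \<le> min (Polynomial.order z f) (Polynomial.order z g)"
    for n
    using order_divides[of z n f] order_divides[of z n g] order_divides[of z n "gcd f g"] assms
    by auto 
  then show ?thesis
    by (meson le_antisym order_refl)
qed

text \<open>The derivative \<open>u X^(u-1)\<close> can vanish only at 0, which is not a zero of
  \<open>X^u - 1\<close>, so all zeros are simple.\<close>

lemma order_monom_minus_1:
  fixes z :: complex
  assumes "u > 0"
  shows "Polynomial.order z (Polynomial.monom 1 u - 1) = (if z ^ u = 1 then 1 else 0 :: nat)"
    (is "Polynomial.order z ?f = _")
proof (cases "z ^ u = (1 :: complex)")
  case True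
  have root: "poly ?f z = 0"
    using True by (simp add: poly_monom)
  have "z \<noteq> 0"
    using True assms by (auto simp: zero_power)
  have d: "poly (pderiv ?f) z \<noteq> 0"
    using \<open>z \<noteq> 0\<close> assms by (simp add: pderiv_diff pderiv_monom poly_monom)
  have "Polynomial.order z ?f = Suc (Polynomial.order z (pderiv ?f))"
    using root monom_minus_1_neq_0[OF assms] by (intro order_pderiv) auto
  then show ?thesis
    using order_0I[OF d] True by simp
next
  case False
  then show ?thesis by (simp add: order_0I poly_monom)
qed

lemma order_power_poly:
  "0 \<notin># U \<Longrightarrow> Polynomial.order z (power_poly U) = size {#u \<in># U. z ^ u = 1#}"
proof (induction U)
  case (add u U)
  then have "power_poly (add_mset u U) \<noteq> 0"
    by (intro power_poly_neq_0) auto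
  then show ?case
    using add by (simp add: order_mult order_monom_minus_1)
qed simp

lemma gcd_mult_eq:
  assumes "0 \<notin># U" "0 \<notin># V" "p > 1"
  shows "gcd_mult p U V k =
    min (size {#u \<in># U. (int p - 1) dvd int u * k#}) (size {#v \<in># V. (int p - 1) dvd int v * k#})"
proof -
  define z where "z = cis (2 * pi * of_int k / (of_nat p - 1))"
  have "z = cis (2 * pi * of_int k / of_nat (p - 1))"
    using assms by (simp add: z_def of_nat_diff)
  then have "z ^ u = 1 \<longleftrightarrow> (int p - 1) dvd int u * k" for u
    using cis_power_eq_1_iff[of "p - 1" k u] assms by (simp add: of_nat_diff)
  then show ?thesis
    unfolding gcd_mult_def z_def[symmetric]
    using assms by (simp add: order_gcd power_poly_neq_0 order_power_poly)
qed

section \<open>Cyclotomic quotients for the three data\<close>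

lemma param_poly_conj:
  "param_poly {#a, 1 - a#} = [:1, - 2 * of_real (cos (2 * pi * of_rat a)), 1:]"
proof -
  define x :: real where "x = 2 * pi * of_rat a"
  have "cis (2 * pi * of_rat (1 - a)) = cis (2 * pi - x)"
    by (simp add: x_def of_rat_diff algebra_simps)
  also have "\<dots> = cis (- x)"
    by (simp add: complex_eq_iff)
  finally have "param_poly {#a, 1 - a#} = [:- cis x, 1:] * [:- cis (- x), 1:]"
    by (simp add: param_poly_def x_def)
  also have "\<dots> = [:1, - (cis x + cis (- x)), 1:]"
    by (simp add: cis_mult)
  also have "cis x + cis (- x) = 2 * of_real (cos x)"
    by (simp add: complex_eq_iff)
  finally show ?thesis by (simp add: x_def)
qed

lemma param_poly_1_half: "param_poly {#1, 1/2#} = [:-1, 0, 1:]"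
  by (simp add: param_poly_def of_rat_divide)

lemma monom_numeral_minus_1:
  "Polynomial.monom 1 1 - 1 = ([:-1, 1:] :: complex poly)"
  "Polynomial.monom 1 2 - 1 = ([:-1, 0, 1:] :: complex poly)"
  "Polynomial.monom 1 3 - 1 = ([:-1, 0, 0, 1:] :: complex poly)"
  "Polynomial.monom 1 4 - 1 = ([:-1, 0, 0, 0, 1:] :: complex poly)"
  "Polynomial.monom 1 6 - 1 = ([:-1, 0, 0, 0, 0, 0, 1:] :: complex poly)"
  by (simp_all add: numeral_eq_Suc monom_Suc monom_0 one_pCons)

text \<open>From \<open>X^2 + 1 = (X^4 - 1) / (X^2 - 1)\<close>.\<close>

lemma exponents_quarter: "exponents {#1/4, 3/4#} {#1, 1/2#} = ({#4#}, {#2, 2#})"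
proof -
  have "cos (2 * pi * of_rat (1 / 4)) = (0 :: real)"
    by (simp add: of_rat_divide)
  then have "param_poly {#1/4, 3/4#} = [:1, 0, 1:]"
    using param_poly_conj[of "1/4"] by simp
  then show ?thesis
    by (intro exponents_eqI) (simp_all add: param_poly_1_half monom_numeral_minus_1)
qed

text \<open>From \<open>X^2 + X + 1 = (X^3 - 1) / (X - 1)\<close>.\<close>

lemma exponents_third: "exponents {#1/3, 2/3#} {#1, 1/2#} = ({#3#}, {#1, 2#})"
proof -
  have c: "cos (2 * pi * of_rat (1 / 3)) = (- 1 / 2 :: real)"
    using cos_120 by (simp add: of_rat_divide)
  have "param_poly {#1/3, 2/3#} = [:1, 1, 1:]"
    using param_poly_conj[of "1/3"] unfolding c by simp
  then show ?thesis
    by (intro exponents_eqI)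
      (simp_all add: param_poly_1_half monom_numeral_minus_1 del: One_nat_def)
qed

text \<open>From \<open>X^2 - X + 1 = (X^6 - 1) (X - 1) / ((X^2 - 1) (X^3 - 1))\<close>.\<close>

lemma exponents_sixth: "exponents {#1/6, 5/6#} {#1, 1/2#} = ({#6, 1#}, {#2, 2, 3#})"
proof -
  have c: "cos (2 * pi * of_rat (1 / 6)) = (1 / 2 :: real)"
    using cos_60 by (simp add: of_rat_divide)
  have "param_poly {#1/6, 5/6#} = [:1, -1, 1:]"
    using param_poly_conj[of "1/6"] unfolding c by simp
  then show ?thesis
    by (intro exponents_eqI)
      (simp_all add: param_poly_1_half monom_numeral_minus_1 del: One_nat_def)
qed

subsection \<open>The field with p elements\<close>

lemma of_int_to_int_mod_ring [simp]: "of_int (to_int_mod_ring x) = (x :: 'p::prime_card mod_ring)"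
  by (simp add: of_int_of_int_mod_ring)

text \<open>A primitive root modulo \<open>p\<close> is carried over to the field type; its first
  \<open>p - 1\<close> powers are distinct and nonzero, hence exhaust the units.\<close>

lemma mod_ring_generator:
  obtains g :: "'p::prime_card mod_ring"
  where "\<And>i. g ^ i = 1 \<longleftrightarrow> CARD('p) - 1 dvd i" "\<And>x. x \<noteq> 0 \<Longrightarrow> \<exists>i. x = g ^ i"
proof -
  have "prime CARD('p)"
    by (rule prime_card)
  then obtain r where r: "ord CARD('p) r = CARD('p) - 1"
    using prime_primitive_root_exists[of "CARD('p)"] \<open>prime CARD('p)\<close> prime_gt_1_nat
      totient_prime
    by (metis residue_primroot_def)
  define g :: "'p mod_ring" where "g = of_nat r"
  have g_pow: "g ^ i = 1 \<longleftrightarrow> CARD('p) - 1 dvd i" for i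
  proof -
    have "g ^ i = 1 \<longleftrightarrow> of_nat (r ^ i) = (of_nat 1 :: 'p mod_ring)"
      by (simp add: g_def)
    also have "\<dots> \<longleftrightarrow> [r ^ i = 1] (mod CARD('p))"
      by (simp only: of_nat_eq_iff_cong_CHAR semiring_char_mod_ring)
    also have "\<dots> \<longleftrightarrow> CARD('p) - 1 dvd i"
      by (simp only: ord_divides r)
    finally show ?thesis .
  qed
  have "CARD('p) - 1 > 0"
    using \<open>prime CARD('p)\<close> prime_gt_1_nat by simp
  then have "g \<noteq> 0"
    using g_pow[of "CARD('p) - 1"] by (auto simp: zero_power)
  have "inj_on (\<lambda>i. g ^ i) {..<CARD('p) - 1}"
  proof (rule linorder_inj_onI)
    fix i j assume ij: "i < j" "i \<in> {..<CARD('p) - 1}" "j \<in> {..<CARD('p) - 1}"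
    have "g ^ j = g ^ i * g ^ (j - i)"
      using ij by (simp flip: power_add)
    moreover have "g ^ (j - i) \<noteq> 1"
      using ij by (simp add: g_pow nat_dvd_not_less)
    ultimately show "g ^ i \<noteq> g ^ j"
      using \<open>g \<noteq> 0\<close> by simp
  qed auto
  then have "card ((\<lambda>i. g ^ i) ` {..<CARD('p) - 1}) = card (UNIV - {0 :: 'p mod_ring})"
    by (simp add: card_image)
  moreover have "(\<lambda>i. g ^ i) ` {..<CARD('p) - 1} \<subseteq> UNIV - {0}"
    using \<open>g \<noteq> 0\<close> by auto
  ultimately have "(\<lambda>i. g ^ i) ` {..<CARD('p) - 1} = UNIV - {0}"
    by (intro card_subset_eq) auto
  then have "\<exists>i. x = g ^ i" if "x \<noteq> 0" for x
    using that by (metis (no_types, lifting) DiffI UNIV_I imageE singletonD)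
  with g_pow show ?thesis by (rule that)
qed

text \<open>Faithfulness of \<open>\<omega>\<close> is extracted from generation: the discrete
  logarithm gives a faithful character \<open>\<chi>\<close>, and since \<open>\<chi>\<close> is a
  power of \<open>\<omega>\<close>, any unit killed by \<open>\<omega>\<close> is killed by
  \<open>\<chi>\<close>.\<close>

lemma generates_characters_eq_1_iff:
  fixes \<omega> :: "'p::prime_card mod_ring \<Rightarrow> complex"
  assumes "generates_characters \<omega>"
  shows "\<omega> x = 1 \<longleftrightarrow> x = 1"
proof
  assume wx: "\<omega> x = 1"
  obtain g :: "'p mod_ring" where g: "\<And>i. g ^ i = 1 \<longleftrightarrow> CARD('p) - 1 dvd i"
      and ex: "\<And>x. x \<noteq> 0 \<Longrightarrow> \<exists>i. x = g ^ i"
    using mod_ring_generator[where ?'p = 'p] by metis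
  define n where "n = CARD('p) - 1"
  have "n > 0"
    using prime_card[where 'a = 'p] prime_gt_1_nat by (simp add: n_def)
  have "g \<noteq> 0"
    using g[of n] \<open>n > 0\<close> by (auto simp: zero_power n_def)
  define z where "z = cis (2 * pi / n)"
  have z: "z ^ i = 1 \<longleftrightarrow> n dvd i" for i
    using cis_power_eq_1_iff[OF \<open>n > 0\<close>, of 1 i] by (simp add: z_def)
  have "z \<noteq> 0" by (simp add: z_def)
  \<comment> \<open>\<open>dlog\<close> will choose an arbitrary exponent, so multiplicativity of
    \<open>\<chi>\<close> rests on \<open>z ^ i\<close> depending only on
    \<open>g ^ i\<close>.\<close>
  have z_eq: "z ^ i = z ^ j" if "g ^ i = g ^ j" for i j
    using that
  proof (induction i j rule: linorder_wlog)
    case (le i j)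
    have "g ^ j = g ^ i * g ^ (j - i)" "z ^ j = z ^ i * z ^ (j - i)"
      using le(1) by (simp_all flip: power_add)
    then show ?case
      using le(2) \<open>g \<noteq> 0\<close> g[of "j - i"] z[of "j - i"] by (simp add: n_def)
  qed auto
  define dlog where "dlog x = (SOME i. x = g ^ i)" for x
  have dlog: "g ^ dlog x = x" if "x \<noteq> 0" for x
    using someI_ex[OF ex[OF that]] by (simp add: dlog_def)
  define \<chi> where "\<chi> x = (if x = 0 then 0 else z ^ dlog x)" for x
  have "\<chi> (x * y) = \<chi> x * \<chi> y" for x y
    by (auto simp: \<chi>_def dlog simp flip: power_add intro!: z_eq) (simp add: dlog power_add)
  moreover have "\<chi> 1 = 1"
    using z_eq[of "dlog 1" 0] by (simp add: \<chi>_def dlog)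
  ultimately have "mult_character \<chi>"
    by (simp add: mult_character_def \<chi>_def)
  then obtain k where k: "\<chi> = char_power \<omega> k"
    using assms by (auto simp: generates_characters_def)
  have "x \<noteq> 0"
    using assms wx by (auto simp: generates_characters_def mult_character_def)
  then have "\<chi> x = 1"
    using wx by (simp add: k char_power_def)
  then have "n dvd dlog x"
    using \<open>x \<noteq> 0\<close> by (simp add: \<chi>_def z)
  then show "x = 1"
    using dlog[OF \<open>x \<noteq> 0\<close>] g n_def by metis
next
  assume "x = 1"
  then show "\<omega> x = 1"
    using assms by (auto simp: generates_characters_def mult_character_def)
qed

lemma quad_char_eq:
  fixes x :: "'p::prime_card mod_ring"
  shows "quad_char x = (if x = 0 then 0 else if \<exists>y. y\<^sup>2 = x then 1 else - 1)"
proof -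
  have cong: "[a = b] (mod int CARD('p)) \<longleftrightarrow> of_int a = (of_int b :: 'p mod_ring)" for a b
    by (simp only: of_int_eq_iff_cong_CHAR semiring_char_mod_ring)
  have "QuadRes (int CARD('p)) (to_int_mod_ring x) \<longleftrightarrow> (\<exists>y. (of_int y)\<^sup>2 = x)"
    by (simp add: QuadRes_def cong)
  also have "\<dots> \<longleftrightarrow> (\<exists>y. y\<^sup>2 = x)"
    by (metis of_int_to_int_mod_ring)
  finally show ?thesis
    by (simp add: quad_char_def Legendre_def cong)
qed

lemma power_card_minus_1:
  fixes x :: "'p::prime_card mod_ring"
  assumes "x \<noteq> 0"
  shows "x ^ (CARD('p) - 1) = 1"
proof -
  obtain g :: "'p mod_ring" where g: "\<And>i. g ^ i = 1 \<longleftrightarrow> CARD('p) - 1 dvd i"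
      and ex: "\<And>x. x \<noteq> 0 \<Longrightarrow> \<exists>i. x = g ^ i"
    using mod_ring_generator[where ?'p = 'p] by metis
  obtain i where "x = g ^ i"
    using ex assms by blast
  then have "x ^ (CARD('p) - 1) = g ^ (i * (CARD('p) - 1))"
    by (simp only: power_mult)
  then show ?thesis
    by (simp only: g dvd_triv_right)
qed

text \<open>For \<open>x = g ^ i\<close> with a generator \<open>g\<close>, the power condition
  forces \<open>i\<close> to be even; the converse is Fermat's little theorem for a square root of
  \<open>x\<close>.\<close>

lemma euler_criterion_mod_ring:
  fixes x :: "'p::prime_card mod_ring"
  assumes "x \<noteq> 0" "odd CARD('p)"
  shows "x ^ ((CARD('p) - 1) div 2) = 1 \<longleftrightarrow> (\<exists>y. y\<^sup>2 = x)"
proof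
  obtain g :: "'p mod_ring" where g: "\<And>i. g ^ i = 1 \<longleftrightarrow> CARD('p) - 1 dvd i"
      and ex: "\<And>x. x \<noteq> 0 \<Longrightarrow> \<exists>i. x = g ^ i"
    using mod_ring_generator[where ?'p = 'p] by metis
  define h where "h = (CARD('p) - 1) div 2"
  have h: "CARD('p) - 1 = 2 * h"
    using assms by (simp add: h_def)
  obtain i where i: "x = g ^ i"
    using ex assms by blast
  assume "x ^ ((CARD('p) - 1) div 2) = 1"
  then have "2 * h dvd i * h"
    using g[of "i * h"] unfolding h by (simp add: i power_mult)
  moreover have "h > 0"
    using prime_card[where 'a = 'p] prime_gt_1_nat[of "CARD('p)"] h by (cases h) auto
  ultimately have "even i"
    by simp
  then show "\<exists>y. y\<^sup>2 = x"
    by (metis i dvd_def mult.commute power_mult)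
next
  assume "\<exists>y. y\<^sup>2 = x"
  then obtain y where y: "x = y\<^sup>2" by blast
  then have "x ^ ((CARD('p) - 1) div 2) = y ^ (CARD('p) - 1)"
    using assms by (simp flip: power_mult)
  moreover have "y \<noteq> 0"
    using y assms by auto
  ultimately show "x ^ ((CARD('p) - 1) div 2) = 1"
    by (metis power_card_minus_1)
qed

lemma three_neq_0:
  assumes "CARD('p) > 3"
  shows "(3 :: 'p::prime_card mod_ring) \<noteq> 0"
proof
  assume "(3 :: 'p mod_ring) = 0"
  then have "CARD('p) dvd 3"
    using of_nat_0_mod_ring_dvd[of 3, where 'a = 'p] by simp
  then show False
    using assms dvd_imp_le[of "CARD('p)" 3] by simp
qed

section \<open>Zeros of the cubic\<close>

lemma poly_cubic: "poly (cubic t) x = x\<^sup>2 * (x + 3) - 4 * t"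
  by (simp add: cubic_def algebra_simps power2_eq_square)

text \<open>The derivative is \<open>3 x (x + 2)\<close>, so a nonzero multiple zero can only be
  \<open>- 2\<close>, where the cubic takes the value \<open>4 (1 - t)\<close>.\<close>

lemma zeros_with_mult_cubic:
  fixes t :: "'p::prime_card mod_ring"
  assumes "CARD('p) > 3" "odd CARD('p)" "t \<noteq> 1"
  shows "zeros_with_mult (cubic t) = zeros_distinct (cubic t)"
proof -
  have "Polynomial.order x (cubic t) = 1" if x: "x \<noteq> 0" "poly (cubic t) x = 0" for x
  proof -
    have "cubic t \<noteq> 0"
      by (simp add: cubic_def)
    then have "Polynomial.order x (cubic t) \<noteq> 0"
      using x(2) order_root by blast
    moreover have "\<not> 2 \<le> Polynomial.order x (cubic t)"
    proof
      assume "2 \<le> Polynomial.order x (cubic t)"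
      then have "[:- x, 1:]\<^sup>2 dvd cubic t"
        by (simp add: order_divides)
      then obtain g where g: "cubic t = [:- x, 1:]\<^sup>2 * g"
        by (elim dvdE)
      have "poly (pderiv (cubic t)) x = 0"
        unfolding g power2_eq_square pderiv_mult poly_add poly_mult by simp
      then have "3 * x * (x + 2) = 0"
        by (simp add: cubic_def pderiv_pCons algebra_simps)
      then have "x = - 2"
        using x(1) three_neq_0[OF assms(1)] by (simp add: eq_neg_iff_add_eq_0)
      then have "4 * (1 - t) = 0"
        using x(2) by (simp add: poly_cubic)
      moreover have "(4 :: 'p mod_ring) \<noteq> 0"
      proof
        assume "(4 :: 'p mod_ring) = 0"
        then have "CARD('p) dvd 2 ^ 2"
          using of_nat_0_mod_ring_dvd[of 4, where 'a = 'p] by simp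
        then have "CARD('p) dvd 2"
          using prime_dvd_power prime_card by blast
        then show False
          using assms(1) dvd_imp_le[of "CARD('p)" 2] by simp
      qed
      ultimately show False
        using assms(3) by simp
    qed
    ultimately show ?thesis by linarith
  qed
  then show ?thesis
    by (simp add: zeros_with_mult_def zeros_distinct_def)
qed

text \<open>The double zero \<open>- 2\<close> is counted once here. This is the count that yields
  the hypergeometric value \<open>2 - 1 = 1\<close> at argument 1.\<close>

lemma zeros_distinct_cubic_1:
  assumes "CARD('p) > 3" "(2 :: 'p mod_ring) \<noteq> 0"
  shows "zeros_distinct (cubic (1 :: 'p::prime_card mod_ring)) = 2"
proof -
  have "poly (cubic 1) x = (x - 1) * (x + 2)\<^sup>2" for x :: "'p mod_ring"
    by (simp add: poly_cubic algebra_simps power2_eq_square)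
  then have "{x :: 'p mod_ring. x \<noteq> 0 \<and> poly (cubic 1) x = 0} = {1, - 2}"
    using assms by (auto simp: eq_neg_iff_add_eq_0)
  moreover have "(1 :: 'p mod_ring) \<noteq> - 2"
    using three_neq_0[OF assms(1)] by (simp add: eq_neg_iff_add_eq_0)
  ultimately show ?thesis
    by (simp add: zeros_distinct_def)
qed

text \<open>Cancels the factor \<open>p - 1\<close> from orthogonality of characters against the
  prefactor \<open>- 1 / (1 - p)\<close> of \<open>hyp_H\<close>.\<close>

lemma cancel_factor:
  fixes a x :: "'a :: field"
  assumes "a \<noteq> 1"
  shows "- ((a - 1) * x) / (1 - a) = x"
proof -
  have "- ((a - 1) * x) = (1 - a) * x"
    by (simp add: algebra_simps)
  then show ?thesis
    using assms by simp
qed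

locale character_setup =
  fixes \<zeta> :: complex and \<omega> :: "'p::prime_card mod_ring \<Rightarrow> complex"
  assumes odd_card: "odd CARD('p)"
    and root: "primitive_root_unity CARD('p) \<zeta>"
    and gen: "generates_characters \<omega>"
begin

abbreviation ch :: "int \<Rightarrow> 'p mod_ring \<Rightarrow> complex" where
  "ch \<equiv> char_power \<omega>"

abbreviation units :: "'p mod_ring set" where
  "units \<equiv> UNIV - {0}"

text \<open>The order of the character group, as an integer because exponents such as
  \<open>- 2 * k\<close> occur; \<open>half\<close> below is the exponent of the quadratic
  character.\<close>

definition period :: int where
  "period = int CARD('p) - 1"

definition half :: int where
  "half = period div 2"

definition add_char :: "'p mod_ring \<Rightarrow> complex" where
  "add_char x = \<zeta> powi to_int_mod_ring x"

definition G :: "int \<Rightarrow> complex" where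
  "G k = gauss_sum \<zeta> (ch k)"

lemma card_ge_3: "CARD('p) \<ge> 3"
  using prime_card[where 'a = 'p] odd_card prime_ge_2_nat[of "CARD('p)"]
  by (cases "CARD('p) = 2") auto

lemma period_pos: "period > 0"
  using card_ge_3 by (simp add: period_def)

lemma period_eq: "period = 2 * half"
  using odd_card by (simp add: period_def half_def)

lemma half_pos: "half > 0"
  using period_eq period_pos by simp

lemma two_neq_0 [simp]: "(2 :: 'p mod_ring) \<noteq> 0"
proof
  assume "(2 :: 'p mod_ring) = 0"
  then have "CARD('p) dvd 2"
    using of_nat_0_mod_ring_dvd[of 2, where 'a = 'p] by simp
  then show False
    using card_ge_3 dvd_imp_le[of "CARD('p)" 2] by simp
qed

lemma four_neq_0 [simp]: "(4 :: 'p mod_ring) \<noteq> 0"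
proof -
  have "(2 :: 'p mod_ring) * 2 \<noteq> 0"
    using two_neq_0 by (simp only: mult_eq_0_iff simp_thms)
  then show ?thesis by simp
qed

subsection \<open>Multiplicative characters\<close>

lemma omega_0: "\<omega> 0 = 0" and omega_1: "\<omega> 1 = 1" and omega_mult: "\<omega> (x * y) = \<omega> x * \<omega> y"
  using gen by (auto simp: generates_characters_def mult_character_def)

lemma omega_power: "\<omega> (x ^ n) = \<omega> x ^ n"
  by (induction n) (simp_all add: omega_1 omega_mult)

lemma omega_eq_1_iff: "\<omega> x = 1 \<longleftrightarrow> x = 1"
  using gen by (rule generates_characters_eq_1_iff)

lemma omega_eq_0_iff: "\<omega> x = 0 \<longleftrightarrow> x = 0"
proof
  assume "\<omega> x = 0"
  then have "\<omega> (x * inverse x) = 0"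
    by (simp add: omega_mult)
  then show "x = 0"
    using omega_1 by (metis right_inverse zero_neq_one)
qed (simp add: omega_0)

lemma ch_at_0 [simp]: "ch k 0 = 0"
  by (simp add: char_power_def)

lemma ch_at_1 [simp]: "ch k 1 = 1"
  by (simp add: char_power_def omega_1)

lemma ch_0: "x \<noteq> 0 \<Longrightarrow> ch 0 x = 1"
  by (simp add: char_power_def)

lemma ch_eq_0_iff: "ch k x = 0 \<longleftrightarrow> x = 0"
  by (simp add: char_power_def omega_eq_0_iff)

lemma ch_mult: "ch k (x * y) = ch k x * ch k y"
  by (simp add: char_power_def omega_mult power_int_mult_distrib)

lemma ch_add: "ch (k + l) x = ch k x * ch l x"
  by (simp add: char_power_def power_int_add omega_eq_0_iff)

lemma ch_minus: "ch (- k) x = inverse (ch k x)"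
  by (simp add: char_power_def power_int_minus)

lemma ch_inverse: "ch k (inverse x) = inverse (ch k x)"
proof (cases "x = 0")
  case False
  then have "ch k x * ch k (inverse x) = 1"
    by (simp flip: ch_mult)
  then show ?thesis
    by (simp add: inverse_unique)
qed simp

lemma ch_power:
  assumes "n > 0"
  shows "ch (int n * k) x = ch k (x ^ n)"
  using assms
  by (simp add: char_power_def omega_power power_int_mult power_int_power mult.commute)

lemma ch_trivial:
  assumes "period dvd k" "x \<noteq> 0"
  shows "ch k x = 1"
proof -
  obtain l where l: "k = period * l"
    using assms by (elim dvdE)
  have "period = int (CARD('p) - 1)"
    using card_ge_3 by (simp add: period_def of_nat_diff)
  then have "\<omega> x powi period = \<omega> (x ^ (CARD('p) - 1))"
    by (simp only: omega_power power_int_of_nat)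
  also have "\<dots> = 1"
    by (simp only: power_card_minus_1[OF assms(2)] omega_1)
  finally show ?thesis
    using assms by (simp add: char_power_def l power_int_mult)
qed

lemma ch_cong:
  assumes "period dvd k - l"
  shows "ch k = ch l"
proof
  fix x
  show "ch k x = ch l x"
  proof (cases "x = 0")
    case False
    have "ch k x = ch (k - l) x * ch l x"
      by (simp flip: ch_add)
    then show ?thesis
      using assms False by (simp add: ch_trivial)
  qed simp
qed

text \<open>A generator of the units is a witness, since \<open>\<omega>\<close> is
  faithful.\<close>

lemma ch_nontrivial:
  assumes "\<not> period dvd k"
  shows "\<exists>x. x \<noteq> 0 \<and> ch k x \<noteq> 1"
proof -
  obtain g :: "'p mod_ring" where g: "\<And>i. g ^ i = 1 \<longleftrightarrow> CARD('p) - 1 dvd i"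
    using mod_ring_generator[where ?'p = 'p] by metis
  have "g \<noteq> 0"
    using g[of "CARD('p) - 1"] card_ge_3 by (auto simp: zero_power)
  define i where "i = nat (k mod period)"
  have i: "int i = k mod period"
    using period_pos by (simp add: i_def)
  have per: "period = int (CARD('p) - 1)"
    using card_ge_3 by (simp add: period_def of_nat_diff)
  have "ch k g = ch (int i) g"
    using ch_cong[of k "int i"] by (simp add: i mod_eq_dvd_iff flip: minus_mod_eq_mult_div)
  also have "\<dots> = \<omega> (g ^ i)"
    using \<open>g \<noteq> 0\<close> by (simp add: char_power_def omega_power)
  finally have "ch k g = 1 \<longleftrightarrow> CARD('p) - 1 dvd i"
    by (simp add: omega_eq_1_iff g)
  also have "\<dots> \<longleftrightarrow> int (CARD('p) - 1) dvd int i"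
    by (simp only: int_dvd_int_iff)
  also have "\<dots> \<longleftrightarrow> period dvd k mod period"
    by (simp only: i per[symmetric])
  also have "\<dots> \<longleftrightarrow> period dvd k"
    by (simp add: dvd_mod_iff)
  finally show ?thesis
    using assms \<open>g \<noteq> 0\<close> by blast
qed

text \<open>A geometric sum with ratio \<open>\<omega> x\<close>, which differs from 1 for
  \<open>x \<noteq> 1\<close> by faithfulness.\<close>

lemma sum_ch_exponents:
  assumes "x \<noteq> 0"
  shows "(\<Sum>k = 0..int CARD('p) - 2. ch k x) = (if x = 1 then of_int period else 0)"
proof -
  have "{0..int CARD('p) - 2} = int ` {..<CARD('p) - 1}"
    using card_ge_3 by (auto simp: image_iff intro!: bexI[of _ "nat _"])
  then have "(\<Sum>k = 0..int CARD('p) - 2. ch k x) = (\<Sum>i<CARD('p) - 1. \<omega> x ^ i)"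
    using assms by (simp add: sum.reindex char_power_def)
  also have "\<dots> = (if x = 1 then of_int period else 0)"
  proof (cases "x = 1")
    case True
    then show ?thesis
      using card_ge_3 by (simp add: omega_1 period_def of_nat_diff)
  next
    case False
    have "\<omega> x ^ (CARD('p) - 1) = \<omega> (x ^ (CARD('p) - 1))"
      by (simp only: omega_power)
    then have "\<omega> x ^ (CARD('p) - 1) = 1"
      by (simp only: power_card_minus_1[OF assms] omega_1)
    then show ?thesis
      using False by (simp add: geometric_sum omega_eq_1_iff del: One_nat_def)
  qed
  finally show ?thesis .
qed

lemma bij_mult: "y \<noteq> 0 \<Longrightarrow> bij (\<lambda>x :: 'p mod_ring. x * y)"
  by (rule o_bij[of "\<lambda>x. x / y"]) (auto simp: fun_eq_iff)

lemma sum_ch: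
  "(\<Sum>x\<in>UNIV. ch k x) = (if period dvd k then of_int period else 0)"
proof (cases "period dvd k")
  case True
  have "(\<Sum>x\<in>UNIV. ch k x) = (\<Sum>x\<in>units. ch k x)"
    by (intro sum.mono_neutral_right) auto
  also have "\<dots> = (\<Sum>x\<in>units. 1)"
    using True by (intro sum.cong) (auto simp: ch_trivial)
  finally show ?thesis
    using True card_ge_3 by (simp add: period_def of_nat_diff)
next
  case False
  then obtain y where y: "y \<noteq> 0" "ch k y \<noteq> 1"
    using ch_nontrivial by blast
  have "(\<Sum>x\<in>UNIV. ch k x) = (\<Sum>x\<in>UNIV. ch k (x * y))"
    by (rule sum.reindex_bij_betw[OF bij_mult[OF y(1)], symmetric])
  also have "\<dots> = (\<Sum>x\<in>UNIV. ch k x) * ch k y"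
    by (simp add: ch_mult sum_distrib_right)
  finally show ?thesis
    using y False by (metis mult_cancel_left2)
qed

subsection \<open>The quadratic character\<close>

abbreviation \<phi> :: "'p mod_ring \<Rightarrow> complex" where
  "\<phi> \<equiv> quad_char"

text \<open>Its square is trivial, so the values on units are \<open>1\<close> and
  \<open>- 1\<close>; Euler's criterion decides which.\<close>

lemma ch_half: "ch half = \<phi>"
proof
  fix x :: "'p mod_ring"
  show "ch half x = \<phi> x"
  proof (cases "x = 0")
    case False
    have "ch half x * ch half x = ch period x"
      by (simp add: period_eq flip: ch_add)
    then have "ch half x ^ 2 = 1"
      using False by (simp add: ch_trivial power2_eq_square)
    then have "ch half x = 1 \<or> ch half x = - 1"
      by (simp add: power2_eq_1_iff)
    moreover have "half = int ((CARD('p) - 1) div 2)"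
      using card_ge_3 by (simp add: half_def period_def of_nat_diff zdiv_int)
    then have "ch half x = \<omega> (x ^ ((CARD('p) - 1) div 2))"
      using False by (simp add: char_power_def omega_power)
    then have "ch half x = 1 \<longleftrightarrow> (\<exists>y. y\<^sup>2 = x)"
      by (simp only: omega_eq_1_iff euler_criterion_mod_ring[OF False odd_card])
    ultimately show ?thesis
      using False by (auto simp: quad_char_eq)
  qed (simp add: quad_char_eq)
qed

lemma quad_mult: "\<phi> (x * y) = \<phi> x * \<phi> y"
  by (simp add: ch_mult flip: ch_half)

lemma quad_square: "x \<noteq> 0 \<Longrightarrow> \<phi> (x\<^sup>2) = 1"
  by (auto simp: quad_char_eq)

lemma quad_0: "\<phi> 0 = 0"
  by (simp add: quad_char_eq)

lemma quad_cases: "x \<noteq> 0 \<Longrightarrow> \<phi> x = 1 \<or> \<phi> x = - 1"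
  by (simp add: quad_char_eq)

lemma quad_mult_self: "x \<noteq> 0 \<Longrightarrow> \<phi> x * \<phi> x = 1"
  using quad_cases[of x] by auto

lemma quad_inverse: "\<phi> (inverse x) = \<phi> x"
  using quad_cases[of x] by (cases "x = 0") (auto simp: ch_inverse simp flip: ch_half)

subsection \<open>The additive character\<close>

lemma zeta_power: "\<zeta> ^ CARD('p) = 1" and zeta_neq_0: "\<zeta> \<noteq> 0"
  using root card_ge_3 by (auto simp: primitive_root_unity_def zero_power)

lemma add_char_add: "add_char (x + y) = add_char x * add_char y"
proof -
  \<comment> \<open>Adding field elements reduces the integer representatives modulo
    \<open>p\<close>, which \<open>\<zeta> ^ p = 1\<close> absorbs.\<close>
  have *: "\<zeta> powi (n mod int CARD('p)) = \<zeta> powi n" for n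
  proof -
    have "\<zeta> powi n = \<zeta> powi (int CARD('p) * (n div int CARD('p)) + n mod int CARD('p))"
      by simp
    also have "\<dots> = (\<zeta> powi int CARD('p)) powi (n div int CARD('p)) * \<zeta> powi (n mod int CARD('p))"
      using zeta_neq_0 by (simp only: power_int_add power_int_mult simp_thms)
    finally show ?thesis
      by (simp add: zeta_power)
  qed
  show ?thesis
    using zeta_neq_0 by (simp add: add_char_def to_int_mod_ring_add * power_int_add)
qed

lemma add_char_0 [simp]: "add_char 0 = 1"
  by (simp add: add_char_def)

lemma add_char_1: "add_char 1 \<noteq> 1"
proof -
  have "to_int_mod_ring (1 :: 'p mod_ring) = 1"
    by transfer simp
  moreover have "\<zeta> ^ 1 \<noteq> 1"
    using root card_ge_3 unfolding primitive_root_unity_def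
    by (metis less_numeral_extra(1) numeral_One one_less_numeral_iff order_less_le_trans semiring_norm(77))
  ultimately show ?thesis
    by (simp add: add_char_def)
qed

lemma sum_add_char: "(\<Sum>x\<in>UNIV. add_char (x * y)) = (if y = 0 then of_nat CARD('p) else 0)"
proof (cases "y = 0")
  case False
  have "(\<Sum>x\<in>UNIV. add_char x) = (\<Sum>x\<in>UNIV. add_char (x + 1))"
    by (rule sum.reindex_bij_betw[symmetric]) (rule bij_plus_right)
  also have "\<dots> = (\<Sum>x\<in>UNIV. add_char x) * add_char 1"
    by (simp add: add_char_add sum_distrib_right)
  finally have "(\<Sum>x\<in>UNIV. add_char x) = 0"
    using add_char_1 by (metis mult_cancel_left2)
  then show ?thesis
    using sum.reindex_bij_betw[OF bij_mult[OF False], of add_char] False by simp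
qed simp

lemma sum_units: "(\<Sum>x\<in>units. f x) = (\<Sum>x\<in>UNIV. f x) - f 0"
  for f :: "'p mod_ring \<Rightarrow> complex"
  by (simp add: sum_diff1)

lemma sum_add_char_units:
  "(\<Sum>x\<in>units. add_char (x * y)) = (if y = 0 then of_nat CARD('p) else 0) - 1"
  by (simp add: sum_units sum_add_char)

subsection \<open>Gauss sums\<close>

lemma G_altdef: "G k = (\<Sum>x\<in>UNIV. ch k x * add_char x)"
  by (simp add: G_def gauss_sum_def sum_units flip: add_char_def)

lemma G_units: "G k = (\<Sum>x\<in>units. ch k x * add_char x)"
  by (simp add: G_altdef sum_units)

text \<open>Substitution of \<open>x * y\<close> for \<open>x\<close>: the form in which a common
  variable is scaled out of products of Gauss sums.\<close>

lemma G_scaled: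
  assumes "y \<noteq> 0"
  shows "G k = (\<Sum>x\<in>UNIV. ch k x * ch k y * add_char (x * y))"
  unfolding G_altdef
  using sum.reindex_bij_betw[OF bij_mult[OF assms], of "\<lambda>x. ch k x * add_char x"]
  by (simp add: ch_mult)

lemma G_scaled_units:
  assumes "y \<noteq> 0"
  shows "G k = (\<Sum>x\<in>units. ch k x * ch k y * add_char (x * y))"
  by (simp add: G_scaled[OF assms] sum_units)

lemma G_cong: "period dvd k - l \<Longrightarrow> G k = G l"
  by (simp add: G_def ch_cong)

lemma G_trivial:
  assumes "period dvd k"
  shows "G k = - 1"
proof -
  have "G k = (\<Sum>x\<in>units. add_char (x * 1))"
    unfolding G_units using assms by (intro sum.cong) (auto simp: ch_trivial)
  then show ?thesis
    by (simp only: sum_add_char_units) simp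
qed

text \<open>After scaling the variable of \<open>G k\<close> by \<open>y\<close>, the sum over
  \<open>y\<close> detects \<open>x = - 1\<close>. The subtracted term is the full sum of
  \<open>ch k\<close>; for the trivial character it leaves \<open>p - (p - 1) = 1\<close>.\<close>

lemma G_mult_G_minus:
  "G k * G (- k) = ch k (- 1) * of_nat CARD('p) - (if period dvd k then of_int period else 0)"
proof -
  have "G k * G (- k) = (\<Sum>y\<in>units. ch (- k) y * add_char y * G k)"
    by (simp add: G_units[of "- k"] sum_distrib_left mult_ac)
  also have "\<dots> = (\<Sum>y\<in>units. \<Sum>x\<in>UNIV. ch k x * add_char (y * (x + 1)))"
  proof (intro sum.cong refl)
    fix y assume "y \<in> units"
    then have "y \<noteq> 0" by simp
    then show "ch (- k) y * add_char y * G k = (\<Sum>x\<in>UNIV. ch k x * add_char (y * (x + 1)))"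
      unfolding G_scaled[OF \<open>y \<noteq> 0\<close>, of k] sum_distrib_left
      by (intro sum.cong)
        (simp_all add: ch_minus ch_eq_0_iff add_char_add field_simps)
  qed
  also have "\<dots> = (\<Sum>x\<in>UNIV. ch k x * (\<Sum>y\<in>units. add_char (y * (x + 1))))"
    by (subst sum.swap) (simp add: sum_distrib_left)
  also have "\<dots> = (\<Sum>x\<in>UNIV. (if x = - 1 then ch k x * of_nat CARD('p) else 0) - ch k x)"
    unfolding sum_add_char_units
    by (intro sum.cong) (auto simp: algebra_simps eq_neg_iff_add_eq_0)
  also have "\<dots> = ch k (- 1) * of_nat CARD('p) - (\<Sum>x\<in>UNIV. ch k x)"
    by (simp add: sum_subtractf)
  finally show ?thesis
    by (simp only: sum_ch)
qed

subsection \<open>Salie sums and the duplication formula\<close>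

text \<open>
  On the fibre of \<open>y \<mapsto> y + m\<^sup>2 / y\<close> over \<open>s\<close> one has \<open>y (s \<plusminus> 2 m) = (y \<plusminus> m)\<^sup>2\<close>, so \<open>\<phi>\<close> is constant
  there unless \<open>s = \<plusminus>2 m\<close>.
\<close>

lemma fibre_sum:
  assumes "m \<noteq> 0"
  shows "(\<Sum>y | y \<noteq> 0 \<and> y + m\<^sup>2 / y = s. \<phi> y) = \<phi> (s + 2 * m) + \<phi> (s - 2 * m)"
proof -
  define A where "A = {y. y \<noteq> 0 \<and> y + m\<^sup>2 / y = s}"
  have A_iff: "y \<in> A \<longleftrightarrow> y * s = y\<^sup>2 + m\<^sup>2" for y
  proof (cases "y = 0")
    case False
    have "y + m\<^sup>2 / y = s \<longleftrightarrow> y * (y + m\<^sup>2 / y) = y * s"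
      using False by simp
    also have "y * (y + m\<^sup>2 / y) = y\<^sup>2 + m\<^sup>2"
      using False by (simp add: distrib_left power2_eq_square)
    finally show ?thesis
      using False by (auto simp: A_def)
  qed (use assms in \<open>simp add: A_def\<close>)
  have plus: "y * (s + 2 * m) = (y + m)\<^sup>2" and minus: "y * (s - 2 * m) = (y - m)\<^sup>2"
    if "y \<in> A" for y
    using that by (simp_all add: A_iff algebra_simps power2_eq_square)
  \<comment> \<open>For \<open>s = 2 m\<close> or \<open>s = - 2 m\<close> the fibre is the single
    point \<open>m\<close> or \<open>- m\<close>, and the right side is \<open>\<phi>\<close> of
    four times that point.\<close>
  have four: "\<phi> (4 * x) = \<phi> x" for x
    using quad_mult[of "2\<^sup>2" x] quad_square[OF two_neq_0] by simp
  consider "s = 2 * m" | "s = - (2 * m)" | "s + 2 * m \<noteq> 0" "s - 2 * m \<noteq> 0"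
    by (auto simp: eq_neg_iff_add_eq_0)
  then have "sum \<phi> A = \<phi> (s + 2 * m) + \<phi> (s - 2 * m)"
  proof cases
    case 1
    have "y = m" if "y \<in> A" for y
      using minus[OF that] 1 by simp
    moreover have "m \<in> A"
      by (simp add: A_iff 1 power2_eq_square algebra_simps)
    ultimately have "A = {m}" by blast
    then show ?thesis
      using 1 four[of m] by (simp add: quad_0)
  next
    case 2
    have "y = - m" if "y \<in> A" for y
      using plus[OF that] 2 by (simp add: eq_neg_iff_add_eq_0)
    moreover have "- m \<in> A"
      by (simp add: A_iff 2 power2_eq_square algebra_simps)
    ultimately have "A = {- m}" by blast
    then show ?thesis
      using 2 four[of "- m"] by (simp add: quad_0)
  next
    case 3
    have val: "\<phi> y = \<phi> (s + 2 * m)" "\<phi> y = \<phi> (s - 2 * m)" if "y \<in> A" for y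
    proof -
      have "y \<noteq> 0" using that by (simp add: A_def)
      have "(y + m)\<^sup>2 \<noteq> 0" "(y - m)\<^sup>2 \<noteq> 0"
        using 3 \<open>y \<noteq> 0\<close> by (simp_all flip: plus[OF that] minus[OF that])
      then have "\<phi> (y * (s + 2 * m)) = 1" "\<phi> (y * (s - 2 * m)) = 1"
        unfolding plus[OF that] minus[OF that] by (intro quad_square; simp)+
      then show "\<phi> y = \<phi> (s + 2 * m)" "\<phi> y = \<phi> (s - 2 * m)"
        using quad_cases[OF \<open>y \<noteq> 0\<close>] quad_cases[OF 3(1)] quad_cases[OF 3(2)]
        by (auto simp: quad_mult)
    qed
    \<comment> \<open>The quadratic \<open>y^2 - s y + m^2\<close> has discriminant
      \<open>(s + 2 m) (s - 2 m)\<close>. If it is a square, the fibre has two points, one for each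
      summand on the right; otherwise the fibre is empty and the summands have opposite
      signs.\<close>
    show ?thesis
    proof (cases "\<exists>d. d\<^sup>2 = (s + 2 * m) * (s - 2 * m)")
      case True
      then obtain d where d: "d\<^sup>2 = (s + 2 * m) * (s - 2 * m)" by blast
      have "d \<noteq> 0" using d 3 by auto
      have "y \<in> A \<longleftrightarrow> (2 * y - s)\<^sup>2 = d\<^sup>2" for y
      proof -
        have "(2 * y - s)\<^sup>2 - d\<^sup>2 = 4 * (y\<^sup>2 + m\<^sup>2 - y * s)"
          unfolding d by (simp add: algebra_simps power2_eq_square)
        then have "(2 * y - s)\<^sup>2 = d\<^sup>2 \<longleftrightarrow> y\<^sup>2 + m\<^sup>2 - y * s = 0"
          using four_neq_0 by (metis eq_iff_diff_eq_0 mult_eq_0_iff)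
        then show ?thesis
          unfolding A_iff by (metis eq_iff_diff_eq_0)
      qed
      then have "y \<in> A \<longleftrightarrow> y = (s + d) / 2 \<or> y = (s - d) / 2" for y
        using two_neq_0 by (auto simp: power2_eq_iff field_simps)
      then have A: "A = {(s + d) / 2, (s - d) / 2}" by blast
      moreover have "(s + d) / 2 \<noteq> (s - d) / 2"
        using \<open>d \<noteq> 0\<close> two_neq_0 by (simp add: field_simps eq_neg_iff_add_eq_0)
      ultimately have "sum \<phi> A = \<phi> ((s + d) / 2) + \<phi> ((s - d) / 2)"
        by simp
      moreover have "(s + d) / 2 \<in> A" "(s - d) / 2 \<in> A"
        unfolding A by simp_all
      ultimately show ?thesis
        using val(1)[of "(s + d) / 2"] val(2)[of "(s - d) / 2"] by metis
    next
      case False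
      have "A = {}"
      proof (rule ccontr)
        assume "A \<noteq> {}"
        then obtain y where "y \<in> A" by blast
        then have "(2 * y - s)\<^sup>2 = (s + 2 * m) * (s - 2 * m)"
          unfolding A_iff by (simp add: algebra_simps power2_eq_square)
        then show False using False by blast
      qed
      moreover have "\<phi> ((s + 2 * m) * (s - 2 * m)) = - 1"
        using False 3 by (simp add: quad_char_eq)
      then have "\<phi> (s + 2 * m) + \<phi> (s - 2 * m) = 0"
        using quad_cases[OF 3(1)] quad_cases[OF 3(2)] by (auto simp: quad_mult)
      ultimately show ?thesis by simp
    qed
  qed
  then show ?thesis by (simp add: A_def)
qed

lemma sum_quad_shift: "(\<Sum>s\<in>UNIV. \<phi> (s - a) * add_char s) = G half * add_char a"
proof -
  have "(\<Sum>s\<in>UNIV. \<phi> (s - a) * add_char s) = (\<Sum>s\<in>UNIV. \<phi> s * add_char (s + a))"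
    using sum.reindex_bij_betw[OF bij_plus_right[of a], of "\<lambda>s. \<phi> (s - a) * add_char s"]
    by simp
  then show ?thesis
    by (simp add: G_altdef ch_half add_char_add sum_distrib_left mult_ac)
qed

text \<open>Grouping the \<open>y\<close> by \<open>s = y + m\<^sup>2 / y\<close> turns the sum into
  two shifted quadratic Gauss sums.\<close>

lemma salie_sum_square:
  assumes "m \<noteq> 0"
  shows "(\<Sum>y\<in>units. \<phi> y * add_char (y + m\<^sup>2 / y)) =
    G half * (add_char (2 * m) + add_char (- 2 * m))"
proof -
  have "(\<Sum>y\<in>units. \<phi> y * add_char (y + m\<^sup>2 / y)) =
      (\<Sum>s\<in>UNIV. \<Sum>y | y \<in> units \<and> y + m\<^sup>2 / y = s. \<phi> y * add_char (y + m\<^sup>2 / y))"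
    by (rule sum.group[symmetric]) auto
  also have "\<dots> = (\<Sum>s\<in>UNIV. (\<Sum>y | y \<noteq> 0 \<and> y + m\<^sup>2 / y = s. \<phi> y) * add_char s)"
    by (intro sum.cong refl) (auto simp: sum_distrib_right intro!: sum.cong)
  also have "\<dots> = (\<Sum>s\<in>UNIV. \<phi> (s - (- 2 * m)) * add_char s) +
      (\<Sum>s\<in>UNIV. \<phi> (s - 2 * m) * add_char s)"
    by (simp add: fibre_sum[OF assms] distrib_right sum.distrib)
  finally show ?thesis
    by (simp only: sum_quad_shift) (simp add: algebra_simps)
qed

text \<open>The involution \<open>y \<mapsto> n / y\<close> preserves \<open>y + n / y\<close> and,
  for a nonsquare \<open>n\<close>, negates \<open>\<phi> y\<close>.\<close>

lemma salie_sum_nonsquare: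
  assumes "\<phi> n = - 1"
  shows "(\<Sum>y\<in>units. \<phi> y * add_char (y + n / y)) = 0"
proof -
  have "n \<noteq> 0" using assms by (auto simp: quad_0)
  have "(\<Sum>y\<in>units. \<phi> y * add_char (y + n / y)) =
      (\<Sum>y\<in>units. \<phi> (n / y) * add_char (n / y + n / (n / y)))"
    using \<open>n \<noteq> 0\<close>
    by (intro sum.reindex_bij_witness[of _ "\<lambda>y. n / y" "\<lambda>y. n / y"]) auto
  also have "\<dots> = - (\<Sum>y\<in>units. \<phi> y * add_char (y + n / y))"
    unfolding sum_negf[symmetric]
  proof (intro sum.cong refl)
    fix y :: "'p mod_ring"
    have "\<phi> (n / y) = - \<phi> y"
      using assms by (simp add: divide_inverse quad_mult quad_inverse)
    moreover have "n / (n / y) = y"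
      using \<open>n \<noteq> 0\<close> by simp
    ultimately show "\<phi> (n / y) * add_char (n / y + n / (n / y)) = - (\<phi> y * add_char (y + n / y))"
      by (simp only: add.commute) simp
  qed
  finally show ?thesis by simp
qed

lemma salie_sum:
  assumes "n \<noteq> 0"
  shows "(\<Sum>y\<in>units. \<phi> y * add_char (y + n / y)) = G half * (\<Sum>m | m\<^sup>2 = n. add_char (2 * m))"
proof (cases "\<exists>m. m\<^sup>2 = n")
  case True
  then obtain m where m: "m\<^sup>2 = n" by blast
  then have "m \<noteq> 0" using assms by auto
  have "{x. x\<^sup>2 = n} = {m, - m}"
    using m by (auto simp: power2_eq_iff)
  moreover have "m \<noteq> - m"
    using \<open>m \<noteq> 0\<close> two_neq_0 by (simp add: eq_neg_iff_add_eq_0 flip: mult_2)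
  ultimately show ?thesis
    using salie_sum_square[OF \<open>m \<noteq> 0\<close>] m by simp
next
  case False
  then have "{m. m\<^sup>2 = n} = {}" "\<phi> n = - 1"
    using assms by (auto simp: quad_char_eq)
  then show ?thesis
    using salie_sum_nonsquare by simp
qed

text \<open>
  The Hasse-Davenport product relation for the quadratic character. Expanding both sides in the
  values \<open>ch k n\<close>, the coefficients are exactly the two sides of the evaluation of Salie sums.
\<close>

lemma G_duplication: "G k * G (k + half) * ch k 4 = G half * G (2 * k)"
proof -
  have "G k * G (k + half) = (\<Sum>y\<in>units. ch k y * \<phi> y * add_char y * G k)"
    by (simp add: G_units[of "k + half"] ch_add ch_half sum_distrib_left mult_ac)
  also have "\<dots> = (\<Sum>y\<in>units. \<Sum>n\<in>UNIV. ch k n * (\<phi> y * add_char (y + n / y)))"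
  proof (intro sum.cong refl)
    fix y :: "'p mod_ring" assume "y \<in> units"
    then have "y \<noteq> 0" "inverse y \<noteq> 0" by simp_all
    then show "ch k y * \<phi> y * add_char y * G k =
        (\<Sum>n\<in>UNIV. ch k n * (\<phi> y * add_char (y + n / y)))"
      unfolding G_scaled[OF \<open>inverse y \<noteq> 0\<close>] sum_distrib_left
      by (intro sum.cong refl) (simp add: ch_inverse ch_eq_0_iff add_char_add divide_inverse mult_ac)
  qed
  also have "\<dots> = (\<Sum>n\<in>UNIV. ch k n * (\<Sum>y\<in>units. \<phi> y * add_char (y + n / y)))"
    by (subst sum.swap) (simp add: sum_distrib_left)
  also have "\<dots> = (\<Sum>n\<in>UNIV. G half * (\<Sum>m | m \<in> UNIV \<and> m\<^sup>2 = n. ch k (m\<^sup>2) * add_char (2 * m)))"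
  proof (intro sum.cong refl)
    fix n :: "'p mod_ring"
    \<comment> \<open>At \<open>n = 0\<close> the Salie evaluation does not apply, but both sides
      vanish because \<open>ch k 0 = 0\<close>.\<close>
    show "ch k n * (\<Sum>y\<in>units. \<phi> y * add_char (y + n / y)) =
        G half * (\<Sum>m | m \<in> UNIV \<and> m\<^sup>2 = n. ch k (m\<^sup>2) * add_char (2 * m))"
      by (cases "n = 0") (simp_all add: salie_sum sum_distrib_left mult_ac)
  qed
  also have "\<dots> = G half * (\<Sum>n\<in>UNIV. \<Sum>m | m \<in> UNIV \<and> m\<^sup>2 = n. ch k (m\<^sup>2) * add_char (2 * m))"
    by (simp only: sum_distrib_left)
  also have "\<dots> = G half * (\<Sum>m\<in>UNIV. ch k (m\<^sup>2) * add_char (2 * m))"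
    by (subst sum.group) auto
  finally have "G k * G (k + half) * ch k 4 =
      G half * (\<Sum>m\<in>UNIV. ch k (m\<^sup>2) * ch k (2\<^sup>2) * add_char (m * 2))"
    by (simp add: sum_distrib_left mult_ac)
  \<comment> \<open>The factor \<open>ch k 4\<close> equals \<open>ch (2 * k) 2\<close>, which is
    what the substitution \<open>m * 2\<close> in \<open>G (2 * k)\<close> produces.\<close>
  also have "(\<Sum>m\<in>UNIV. ch k (m\<^sup>2) * ch k (2\<^sup>2) * add_char (m * 2)) = G (2 * k)"
    unfolding G_scaled[OF two_neq_0] using ch_power[of 2 k] by simp
  finally show ?thesis .
qed

subsection \<open>Point counts from Gauss sums\<close>

text \<open>Scaling \<open>y\<close> and \<open>z\<close> by \<open>x\<close> makes the three
  multiplicative characters of \<open>x\<close> cancel, as \<open>(b + c) - b - c = 0\<close>; what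
  remains in \<open>x\<close> is a sum of \<open>add_char (x * (1 + y + z))\<close>.\<close>

lemma triple_product:
  fixes b c :: nat
  assumes "b > 0" "c > 0"
  shows "G (int (b + c) * k) * G (- int b * k) * G (- int c * k) =
    (\<Sum>y\<in>units. \<Sum>z\<in>units. ch k (inverse (y ^ b * z ^ c)) *
      ((if 1 + y + z = 0 then of_nat CARD('p) else 0) - 1))"
proof -
  have pow: "ch (- int b * k) y = ch k (inverse (y ^ b))" "ch (- int c * k) y = ch k (inverse (y ^ c))"
    for y
    using assms ch_power[of _ k y] ch_minus[of "int b * k"] ch_minus[of "int c * k"]
    by (simp_all add: ch_inverse)
  have "G (int (b + c) * k) * G (- int b * k) * G (- int c * k) =
      (\<Sum>x\<in>units. ch (int (b + c) * k) x * add_char x * (G (- int b * k) * G (- int c * k)))"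
    by (simp only: G_units[of "int (b + c) * k"] sum_distrib_right mult.assoc)
  also have "\<dots> = (\<Sum>x\<in>units. \<Sum>y\<in>units. \<Sum>z\<in>units.
      ch k (inverse (y ^ b * z ^ c)) * add_char (x * (1 + y + z)))"
  proof (intro sum.cong refl)
    fix x :: "'p mod_ring" assume "x \<in> units"
    then have x: "x \<noteq> 0" by simp
    have one: "ch (int (b + c) * k) x * ch (- int b * k) x * ch (- int c * k) x = 1"
      using x by (simp flip: ch_add add: ch_0 algebra_simps)
    show "ch (int (b + c) * k) x * add_char x * (G (- int b * k) * G (- int c * k)) =
      (\<Sum>y\<in>units. \<Sum>z\<in>units. ch k (inverse (y ^ b * z ^ c)) * add_char (x * (1 + y + z)))"
      unfolding G_scaled_units[OF x, of "- int b * k"] G_scaled_units[OF x, of "- int c * k"]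
        sum_product unfolding sum_distrib_left
    proof (intro sum.cong refl)
      fix y z :: "'p mod_ring"
      have "ch (int (b + c) * k) x * add_char x *
        (ch (- int b * k) y * ch (- int b * k) x * add_char (y * x) *
         (ch (- int c * k) z * ch (- int c * k) x * add_char (z * x))) =
        (ch (int (b + c) * k) x * ch (- int b * k) x * ch (- int c * k) x) *
        (ch (- int b * k) y * ch (- int c * k) z) * (add_char x * add_char (y * x) * add_char (z * x))"
        by (simp only: mult_ac)
      also have "\<dots> = ch k (inverse (y ^ b * z ^ c)) * add_char (x * (1 + y + z))"
        unfolding one unfolding pow by (simp add: add_char_add ch_mult algebra_simps)
      finally show "ch (int (b + c) * k) x * add_char x *
        (ch (- int b * k) y * ch (- int b * k) x * add_char (y * x) *
         (ch (- int c * k) z * ch (- int c * k) x * add_char (z * x))) =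
         ch k (inverse (y ^ b * z ^ c)) * add_char (x * (1 + y + z))" .
    qed
  qed
  also have "\<dots> = (\<Sum>y\<in>units. \<Sum>x\<in>units. \<Sum>z\<in>units.
      ch k (inverse (y ^ b * z ^ c)) * add_char (x * (1 + y + z)))"
    by (rule sum.swap)
  also have "\<dots> = (\<Sum>y\<in>units. \<Sum>z\<in>units. \<Sum>x\<in>units.
      ch k (inverse (y ^ b * z ^ c)) * add_char (x * (1 + y + z)))"
    by (intro sum.cong refl sum.swap)
  finally show ?thesis
    by (simp only: sum_add_char_units flip: sum_distrib_left)
qed

lemma triple_sum:
  fixes b c :: nat
  assumes "b > 0" "c > 0" "d \<noteq> 0"
  shows "(\<Sum>k = 0..int CARD('p) - 2.
      G (int (b + c) * k) * G (- int b * k) * G (- int c * k) * ch k d) =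
    of_int period *
      (of_nat CARD('p) * of_nat (card {(y, z). y ^ b * z ^ c = d \<and> 1 + y + z = 0}) -
       of_nat (card {(y, z). y ^ b * z ^ c = d}))"
proof -
  define w :: "'p mod_ring \<times> 'p mod_ring \<Rightarrow> complex" where
    "w = (\<lambda>(y, z). (if 1 + y + z = 0 then of_nat CARD('p) else 0) - 1)"
  define A where "A = {(y, z). y ^ b * z ^ c = d}"
  define B where "B = {(y, z). y ^ b * z ^ c = d \<and> 1 + y + z = 0}"
  have "(\<Sum>k = 0..int CARD('p) - 2.
      G (int (b + c) * k) * G (- int b * k) * G (- int c * k) * ch k d) =
    (\<Sum>k = 0..int CARD('p) - 2. \<Sum>(y, z)\<in>units \<times> units. w (y, z) * ch k (d / (y ^ b * z ^ c)))"
    unfolding triple_product[OF assms(1,2)] sum.cartesian_product[symmetric] sum_distrib_right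
    by (intro sum.cong refl) (simp add: w_def ch_mult divide_inverse mult_ac)
  also have "\<dots> = (\<Sum>(y, z)\<in>units \<times> units.
      w (y, z) * (\<Sum>k = 0..int CARD('p) - 2. ch k (d / (y ^ b * z ^ c))))"
    by (subst sum.swap) (simp add: sum_distrib_left case_prod_unfold)
  also have "\<dots> = (\<Sum>yz\<in>units \<times> units. if yz \<in> A then of_int period * w yz else 0)"
  proof (intro sum.cong refl)
    fix yz assume "yz \<in> units \<times> units"
    then obtain y z where yz: "yz = (y, z)" "y \<noteq> 0" "z \<noteq> 0"
      by auto
    have nz: "d / (y ^ b * z ^ c) \<noteq> 0"
      using yz assms by simp
    have eq_1: "d / (y ^ b * z ^ c) = 1 \<longleftrightarrow> yz \<in> A"
      using yz by (auto simp: A_def)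
    show "(case yz of (y, z) \<Rightarrow> w (y, z) * (\<Sum>k = 0..int CARD('p) - 2. ch k (d / (y ^ b * z ^ c)))) =
        (if yz \<in> A then of_int period * w yz else 0)"
      unfolding yz(1) prod.case sum_ch_exponents[OF nz] eq_1[unfolded yz(1)] by simp
  qed
  also have "\<dots> = (\<Sum>yz\<in>A. of_int period * w yz)"
  proof -
    \<comment> \<open>Since \<open>d\<close> is nonzero and \<open>b\<close>, \<open>c\<close> are
      positive, no solution has a zero coordinate, so counting over units counts all pairs.\<close>
    have "A \<subseteq> units \<times> units"
      using assms by (auto simp: A_def zero_power)
    then show ?thesis
      by (simp add: sum.inter_restrict[symmetric] Int_absorb1)
  qed
  also have "\<dots> = of_int period * ((\<Sum>yz\<in>A. if yz \<in> B then of_nat CARD('p) else 0) - of_nat (card A))"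
    by (simp only: sum_distrib_left[symmetric])
      (auto simp: w_def A_def B_def sum_subtractf case_prod_unfold intro!: sum.cong)
  also have "(\<Sum>yz\<in>A. if yz \<in> B then of_nat CARD('p) else 0) = (of_nat CARD('p) * of_nat (card B) :: complex)"
  proof -
    have "A \<inter> B = B"
      by (auto simp: A_def B_def)
    then show ?thesis
      by (simp add: sum.inter_restrict[symmetric])
  qed
  finally show ?thesis
    by (simp add: A_def B_def)
qed

subsection \<open>Evaluation of the hypergeometric functions\<close>

lemma hyp_H_eq:
  assumes "exponents \<alpha> \<beta> = (U, V)"
  shows "hyp_H \<zeta> \<omega> \<alpha> \<beta> t =
    (- 1) ^ (size U + size V) / (1 - of_nat CARD('p)) *
    (\<Sum>k = 0..int CARD('p) - 2.
      of_nat CARD('p) powi (- int (gcd_mult CARD('p) U V 0) + int (gcd_mult CARD('p) U V k)) *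
      (\<Prod>u\<in>#U. G (int u * k)) * (\<Prod>v\<in>#V. G (- int v * k)) *
      ch k ((- 1) ^ sum_mset V * inverse (exponents_norm U V) * t))"
  by (simp add: hyp_H_def assms G_def Let_def)

text \<open>The gcd of \<open>X^4 - 1\<close> and \<open>(X^2 - 1)^2\<close> is
  \<open>X^2 - 1\<close>.\<close>

lemma gcd_mult_quarter: "gcd_mult CARD('p) {#4#} {#2, 2#} k = of_bool (period dvd 2 * k)"
proof -
  have "period dvd 4 * k" if "period dvd 2 * k"
    using dvd_mult[OF that, of 2] by simp
  then show ?thesis
    using card_ge_3
    by (cases "period dvd 2 * k") (simp_all add: gcd_mult_eq flip: period_def)
qed

text \<open>The gcd of \<open>X^3 - 1\<close> and \<open>(X - 1) (X^2 - 1)\<close> is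
  \<open>X - 1\<close>.\<close>

lemma gcd_mult_third: "gcd_mult CARD('p) {#3#} {#1, 2#} k = of_bool (period dvd k)"
proof -
  have "period dvd k" if "period dvd 2 * k" "period dvd 3 * k"
    using dvd_diff[OF that(2,1)] by simp
  then show ?thesis
    using card_ge_3 by (auto simp: gcd_mult_eq min_def simp flip: period_def)
qed

text \<open>The gcd of \<open>(X^6 - 1) (X - 1)\<close> and \<open>(X^2 - 1)^2 (X^3 - 1)\<close> is
  \<open>(X^2 - 1) (X^3 - 1)\<close>.\<close>

lemma gcd_mult_sixth:
  "gcd_mult CARD('p) {#6, 1#} {#2, 2, 3#} k = of_bool (period dvd 2 * k) + of_bool (period dvd 3 * k)"
proof -
  have "period dvd k" if "period dvd 2 * k" "period dvd 3 * k"
    using dvd_diff[OF that(2,1)] by simp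
  moreover have "period dvd 6 * k" if "period dvd 2 * k"
    using dvd_mult[OF that, of 3] by simp
  moreover have "period dvd 6 * k" if "period dvd 3 * k"
    using dvd_mult[OF that, of 2] by simp
  ultimately show ?thesis
    using card_ge_3 by (auto simp: gcd_mult_eq min_def simp flip: period_def)
qed

text \<open>Both sides say that \<open>k\<close> is congruent to \<open>half\<close> modulo
  \<open>period\<close>. This matches the powers of \<open>p\<close> in the sixth and the shifted
  third summands.\<close>

lemma period_dvd_shift:
  "period dvd k + half \<longleftrightarrow> period dvd 2 * k \<and> \<not> period dvd k"
proof -
  have "period dvd 2 * k \<longleftrightarrow> half dvd k"
    by (simp add: period_eq)
  moreover have "half dvd k" if "period dvd k + half"
  proof -
    have "half dvd period" by (simp add: period_eq)
    then have "half dvd k + half" using that by (rule dvd_trans)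
    then show ?thesis by simp
  qed
  moreover have "period dvd k + half \<longleftrightarrow> \<not> period dvd k" if half_dvd: "half dvd k"
  proof -
    obtain l where l: "k = half * l"
      using half_dvd by (elim dvdE)
    have "k + half = half * (l + 1)"
      by (simp add: l algebra_simps)
    moreover have "period dvd half * m \<longleftrightarrow> even m" for m
      using half_pos by (simp add: period_eq mult.commute)
    ultimately show ?thesis
      by (simp only: l even_plus_one_iff)
  qed
  ultimately show ?thesis by blast
qed

lemma q_neq_0: "of_nat CARD('p) \<noteq> (0 :: complex)" and q_neq_1: "of_nat CARD('p) \<noteq> (1 :: complex)"
  using card_ge_3 by auto

lemma of_period: "of_int period = (of_nat CARD('p) - 1 :: complex)"
  by (simp add: period_def)

section \<open>Counting solutions over the field\<close>

lemma card_mult_eq: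
  assumes "d \<noteq> 0" "c > 0"
  shows "of_nat (card {(y :: 'p mod_ring, z). y * z ^ c = d}) = (of_nat CARD('p) - 1 :: complex)"
proof -
  have "y * z ^ c = d \<longleftrightarrow> z \<noteq> 0 \<and> y = d / z ^ c" for y z
    using assms by (cases "z = 0") (simp_all add: zero_power eq_divide_eq)
  then have "{(y, z). y * z ^ c = d} = (\<lambda>z. (d / z ^ c, z)) ` units"
    by (auto simp: image_iff)
  moreover have "inj_on (\<lambda>z. (d / z ^ c, z)) units"
    by (rule inj_onI) simp
  ultimately have "card {(y, z). y * z ^ c = d} = card units"
    by (simp only: card_image)
  then show ?thesis
    using card_ge_3 by (simp add: of_nat_diff)
qed

lemma card_square_roots: "of_nat (card {x. x\<^sup>2 = a}) = 1 + \<phi> a"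
proof (cases "a \<noteq> 0 \<and> (\<exists>x. x\<^sup>2 = a)")
  case True
  then obtain x where x: "x\<^sup>2 = a" "x \<noteq> 0"
    by auto
  then have "{x. x\<^sup>2 = a} = {x, - x}"
    by (auto simp: power2_eq_iff)
  moreover have "x \<noteq> - x"
    using x by (simp add: eq_neg_iff_add_eq_0 flip: mult_2)
  ultimately show ?thesis
    using True by (simp add: quad_char_eq)
next
  case False
  then show ?thesis
    by (cases "a = 0") (auto simp: quad_char_eq)
qed

lemma add_one_eq_0_iff: "1 + y + z = 0 \<longleftrightarrow> y = - 1 - z" for y z :: "'p mod_ring"
proof -
  have "1 + y + z = y - (- 1 - z)" by simp
  then show ?thesis by (simp only: right_minus_eq)
qed

text \<open>Eliminating \<open>y\<close> leaves a quadratic in \<open>z\<close>; completing the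
  square with \<open>x = 2 z + 1\<close> gives \<open>x^2 = 1 - 4 e\<close>.\<close>

lemma card_sum_prod_eq:
  "of_nat (card {(y :: 'p mod_ring, z). y * z = e \<and> 1 + y + z = 0}) = 1 + \<phi> (1 - 4 * e)"
proof -
  have key: "(- 1 - z) * z = e \<longleftrightarrow> (2 * z + 1)\<^sup>2 = 1 - 4 * e" for z :: "'p mod_ring"
  proof -
    have "4 * (e - (- 1 - z) * z) = (2 * z + 1)\<^sup>2 - (1 - 4 * e)"
      by (simp add: algebra_simps power2_eq_square)
    then show ?thesis
      by (metis eq_iff_diff_eq_0 four_neq_0 mult_eq_0_iff)
  qed
  have "bij_betw (\<lambda>(y, z). 2 * z + 1) {(y :: 'p mod_ring, z). y * z = e \<and> y = - 1 - z}
      {x. x\<^sup>2 = 1 - 4 * e}"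
  proof (rule bij_betw_byWitness[where f' = "\<lambda>x. (- 1 - (x - 1) / 2, (x - 1) / 2)"])
    show "(\<lambda>(y, z). 2 * z + 1) ` {(y :: 'p mod_ring, z). y * z = e \<and> y = - 1 - z}
        \<subseteq> {x. x\<^sup>2 = 1 - 4 * e}"
    proof (intro image_subsetI)
      fix yz :: "'p mod_ring \<times> 'p mod_ring"
      assume "yz \<in> {(y, z). y * z = e \<and> y = - 1 - z}"
      then obtain z where z: "yz = (- 1 - z, z)" "(- 1 - z) * z = e"
        by blast
      show "(case yz of (y, z) \<Rightarrow> 2 * z + 1) \<in> {x. x\<^sup>2 = 1 - 4 * e}"
        using z(2) unfolding key z(1) by simp
    qed
    show "(\<lambda>x. (- 1 - (x - 1) / 2, (x - 1) / 2)) ` {x. x\<^sup>2 = 1 - 4 * e}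
        \<subseteq> {(y :: 'p mod_ring, z). y * z = e \<and> y = - 1 - z}"
    proof (intro image_subsetI)
      fix x :: "'p mod_ring" assume "x \<in> {x. x\<^sup>2 = 1 - 4 * e}"
      then have "(- 1 - (x - 1) / 2) * ((x - 1) / 2) = e"
        unfolding key by simp
      then show "(- 1 - (x - 1) / 2, (x - 1) / 2) \<in> {(y, z). y * z = e \<and> y = - 1 - z}"
        by blast
    qed
  qed auto
  then show ?thesis
    unfolding add_one_eq_0_iff card_square_roots[symmetric] by (simp only: bij_betw_same_card)
qed

text \<open>The range of summation is a full residue system modulo \<open>p - 1\<close>, which a
  shift permutes.\<close>

lemma sum_shift:
  fixes f :: "int \<Rightarrow> complex"
  assumes "\<And>k l. period dvd k - l \<Longrightarrow> f k = f l"
  shows "(\<Sum>k = 0..int CARD('p) - 2. f (k + half)) = (\<Sum>k = 0..int CARD('p) - 2. f k)"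
proof -
  have S: "{0..int CARD('p) - 2} = {0..<period}"
    by (auto simp: period_def)
  have in_S: "k mod period \<in> {0..<period}" for k
    using period_pos by simp
  show ?thesis
    unfolding S
  proof (rule sum.reindex_bij_witness[of _ "\<lambda>k. (k - half) mod period" "\<lambda>k. (k + half) mod period"])
    fix k assume "k \<in> {0..<period}"
    then show "((k + half) mod period - half) mod period = k"
      "((k - half) mod period + half) mod period = k"
      by (simp_all add: mod_simps)
    show "f ((k + half) mod period) = f (k + half)"
      by (rule assms) (simp add: mod_eq_dvd_iff[symmetric])
  qed (rule in_S)+
qed

lemma half_in_range: "half \<in> {0..int CARD('p) - 2}"
  using half_pos period_eq by (auto simp: period_def)

lemma period_dvd_range:
  assumes "k \<in> {0..int CARD('p) - 2}"
  shows "period dvd k \<longleftrightarrow> k = 0" "period dvd 2 * k \<longleftrightarrow> k = 0 \<or> k = half"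
proof -
  have k: "0 \<le> k" "k < period"
    using assms by (auto simp: period_def)
  then show "period dvd k \<longleftrightarrow> k = 0"
    by (metis dvd_0_right less_le zdvd_not_zless)
  show "period dvd 2 * k \<longleftrightarrow> k = 0 \<or> k = half"
  proof
    assume "period dvd 2 * k"
    then obtain l where l: "2 * k = period * l" by (elim dvdE)
    then have k_eq: "k = half * l" by (simp add: period_eq)
    then have "0 \<le> l" "l < 2"
      using k half_pos by (auto simp: period_eq zero_le_mult_iff mult.commute)
    then have "l = 0 \<or> l = 1" by auto
    then show "k = 0 \<or> k = half" using k_eq by auto
  qed (auto simp: period_eq)
qed

text \<open>The exponent \<open>- 1\<close> is \<open>- s(0)\<close>. The summand is kept as a
  function of every integer \<open>k\<close>, so that it can be shifted by
  \<open>half\<close>.\<close>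

definition third_term :: "'p mod_ring \<Rightarrow> int \<Rightarrow> complex" where
  "third_term d k = of_nat CARD('p) powi (- 1 + of_bool (period dvd k)) * G (3 * k) * (G (- k) * G (- 2 * k)) * ch k d"

lemma third_term_cong:
  assumes "period dvd k - l"
  shows "third_term d k = third_term d l"
proof -
  have diff: "period dvd a * k - a * l" for a
    using assms by (metis dvd_mult right_diff_distrib)
  have "period dvd k \<longleftrightarrow> period dvd l"
    using assms by (metis diff_add_cancel dvd_add_right_iff)
  moreover have "G (3 * k) = G (3 * l)" "G (- k) = G (- l)" "G (- 2 * k) = G (- 2 * l)"
    using diff[of 3] diff[of "- 1"] diff[of "- 2"] by (auto intro!: G_cong)
  ultimately show ?thesis
    by (simp only: third_term_def ch_cong[OF assms])
qed

text \<open>The weight is 1 on \<open>S\<close> and \<open>1 / p\<close> elsewhere, so the power of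
  \<open>p\<close> becomes a correction supported on \<open>S\<close>.\<close>

lemma weighted_sum:
  assumes "S \<subseteq> {0..int CARD('p) - 2}"
  shows "(\<Sum>k = 0..int CARD('p) - 2. of_nat CARD('p) powi (- 1 + of_bool (k \<in> S)) * T k) =
    (\<Sum>k = 0..int CARD('p) - 2. T k) / of_nat CARD('p) + (1 - 1 / of_nat CARD('p)) * (\<Sum>k\<in>S. T k :: complex)"
proof -
  let ?q = "of_nat CARD('p) :: complex"
  have "?q powi (- 1 + of_bool (k \<in> S)) * T k =
      T k / ?q + (1 - 1 / ?q) * (if k \<in> S then T k else 0)" for k
    using q_neq_0 by (simp add: power_int_minus field_simps)
  then have "(\<Sum>k = 0..int CARD('p) - 2. ?q powi (- 1 + of_bool (k \<in> S)) * T k) =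
      (\<Sum>k = 0..int CARD('p) - 2. T k) / ?q +
      (1 - 1 / ?q) * (\<Sum>k = 0..int CARD('p) - 2. if k \<in> S then T k else 0)"
    by (simp only: sum.distrib sum_divide_distrib sum_distrib_left)
  also have "(\<Sum>k = 0..int CARD('p) - 2. if k \<in> S then T k else 0) = (\<Sum>k\<in>S. T k)"
    using assms by (simp add: sum.inter_restrict[symmetric] Int_absorb1)
  finally show ?thesis .
qed

lemma zero_in_range: "0 \<in> {0..int CARD('p) - 2}"
  using card_ge_3 by simp

text \<open>With \<open>y = - 1 - z\<close> and \<open>x = 3 z\<close>, the first equation times 27
  becomes the vanishing of the cubic at \<open>x\<close>; \<open>t \<noteq> 0\<close> excludes
  \<open>x = 0\<close>.\<close>

lemma card_third:
  assumes "CARD('p) > 3" "t \<noteq> 0"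
  shows "card {(y :: 'p mod_ring, z). y * z\<^sup>2 = - 4 * t / 27 \<and> 1 + y + z = 0} =
    card {x. x \<noteq> 0 \<and> poly (cubic t) x = 0}"
proof -
  have nz: "(3 :: 'p mod_ring) \<noteq> 0"
    using assms(1) by (rule three_neq_0)
  have "(3 :: 'p mod_ring) ^ 3 \<noteq> 0"
    using nz by (simp only: power_eq_0_iff simp_thms)
  then have nz27: "(27 :: 'p mod_ring) \<noteq> 0" by simp
  have key: "(- 1 - z) * z\<^sup>2 = - 4 * t / 27 \<longleftrightarrow> poly (cubic t) (3 * z) = 0" for z
  proof -
    have "(- 1 - z) * z\<^sup>2 = - 4 * t / 27 \<longleftrightarrow> (- 1 - z) * z\<^sup>2 * 27 = - 4 * t"
      by (rule nonzero_eq_divide_eq) fact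
    also have "\<dots> \<longleftrightarrow> (- 1 - z) * z\<^sup>2 * 27 + 4 * t = 0"
      by (simp only: minus_mult_left[symmetric] eq_neg_iff_add_eq_0)
    also have "(- 1 - z) * z\<^sup>2 * 27 + 4 * t = - poly (cubic t) (3 * z)"
      by (simp add: poly_cubic algebra_simps power2_eq_square)
    finally show ?thesis by simp
  qed
  have "{(y, z). y * z\<^sup>2 = - 4 * t / 27 \<and> y = - 1 - z} =
      (\<lambda>x. (- 1 - x / 3, x / 3)) ` {x. x \<noteq> 0 \<and> poly (cubic t) x = 0}" (is "?A = ?f ` ?B")
  proof (intro equalityI subsetI)
    fix yz assume "yz \<in> ?A"
    then obtain z where z: "yz = (- 1 - z, z)" "(- 1 - z) * z\<^sup>2 = - 4 * t / 27"
      by blast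
    then have "poly (cubic t) (3 * z) = 0"
      by (simp only: key)
    moreover from this have "3 * z \<noteq> 0"
      using assms(2) by (auto simp: poly_cubic)
    moreover have "yz = ?f (3 * z)"
      using nz by (simp add: z)
    ultimately show "yz \<in> ?f ` ?B" by blast
  next
    fix yz assume "yz \<in> ?f ` ?B"
    then obtain x where x: "yz = ?f x" "poly (cubic t) x = 0" by blast
    then have "poly (cubic t) (3 * (x / 3)) = 0"
      using nz by simp
    then show "yz \<in> ?A"
      unfolding x(1) key[symmetric] by blast
  qed
  moreover have "inj_on ?f ?B"
    by (rule inj_onI) (use nz in simp)
  ultimately show ?thesis
    unfolding add_one_eq_0_iff by (simp only: card_image)
qed

text \<open>Writing \<open>q = p\<close> and \<open>n\<close> for the count,
  \<open>(q - 1) (q n - (q - 1)) / q\<close> and the correction \<open>- (1 - 1 / q)\<close> at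
  \<open>k = 0\<close> add up to \<open>(q - 1) (n - 1)\<close>.\<close>

lemma sum_third_term:
  assumes "d \<noteq> 0"
  shows "(\<Sum>k = 0..int CARD('p) - 2. third_term d k) =
    (of_nat CARD('p) - 1) *
    (of_nat (card {(y :: 'p mod_ring, z). y * z\<^sup>2 = d \<and> 1 + y + z = 0}) - 1)"
proof -
  let ?q = "of_nat CARD('p) :: complex"
  define T where "T k = G (3 * k) * G (- k) * G (- 2 * k) * ch k d" for k
  have "(\<Sum>k = 0..int CARD('p) - 2. third_term d k) =
      (\<Sum>k = 0..int CARD('p) - 2. ?q powi (- 1 + of_bool (k \<in> {0})) * T k)"
    by (intro sum.cong refl) (simp add: third_term_def T_def period_dvd_range mult_ac)
  also have "\<dots> = (\<Sum>k = 0..int CARD('p) - 2. T k) / ?q + (1 - 1 / ?q) * (\<Sum>k\<in>{0}. T k)"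
    by (rule weighted_sum) (use zero_in_range in blast)
  also have "(\<Sum>k\<in>{0}. T k) = - 1"
    using assms by (simp add: T_def G_trivial ch_0)
  also have "(\<Sum>k = 0..int CARD('p) - 2. T k) =
      (?q - 1) * (?q * of_nat (card {(y :: 'p mod_ring, z). y * z\<^sup>2 = d \<and> 1 + y + z = 0}) - (?q - 1))"
    using triple_sum[of 1 2 d] card_mult_eq[of d 2] assms
    by (simp add: T_def of_period)
  finally show ?thesis
    using q_neq_0 by (simp add: field_simps)
qed

text \<open>Three exponents give the leading minus sign; \<open>N = 27 / 4\<close> and
  \<open>(-1)^(1+2)\<close> give the argument \<open>- 4 * t / 27\<close>.\<close>

lemma hyp_H_third_term:
  assumes "CARD('p) > 3"
  shows "hyp_H \<zeta> \<omega> {#1/3, 2/3#} {#1, 1/2#} t =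
    - (\<Sum>k = 0..int CARD('p) - 2. third_term (- 4 * t / 27) k) / (1 - of_nat CARD('p))"
proof -
  have norm: "(- 1) ^ sum_mset {#1, 2#} * inverse (exponents_norm {#3#} {#1, 2#}) * t = - 4 * t / 27"
    by (simp add: exponents_norm_def)
  show ?thesis
    unfolding hyp_H_eq[OF exponents_third] gcd_mult_third norm
    by (simp add: third_term_def mult.assoc)
qed

lemma hyp_H_third:
  assumes "CARD('p) > 3" "t \<noteq> 0"
  shows "hyp_H \<zeta> \<omega> {#1/3, 2/3#} {#1, 1/2#} t = of_nat (zeros_distinct (cubic t)) - 1"
proof -
  have "(3 :: 'p mod_ring) ^ 3 \<noteq> 0"
    using three_neq_0[OF assms(1)] by (simp only: power_eq_0_iff simp_thms)
  then have "(27 :: 'p mod_ring) \<noteq> 0"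
    by simp
  then have "- 4 * t / 27 \<noteq> 0"
    using assms by simp
  show ?thesis
    unfolding hyp_H_third_term[OF assms(1)] sum_third_term[OF \<open>- 4 * t / 27 \<noteq> 0\<close>]
      card_third[OF assms] zeros_distinct_def
    by (rule cancel_factor[OF q_neq_1])
qed

section \<open>The parameters 1/4 and 3/4\<close>

lemma card_quarter_nonsquare:
  assumes "\<phi> t = - 1"
  shows "{(y :: 'p mod_ring, z). y\<^sup>2 * z\<^sup>2 = t / 16} = {}"
proof (rule ccontr)
  assume "{(y :: 'p mod_ring, z). y\<^sup>2 * z\<^sup>2 = t / 16} \<noteq> {}"
  then obtain y z where yz: "y\<^sup>2 * z\<^sup>2 = t / 16" by blast
  have sixteen: "(16 :: 'p mod_ring) = 4\<^sup>2" by simp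
  then have "(16 :: 'p mod_ring) \<noteq> 0"
    by (simp only: power_eq_0_iff four_neq_0 simp_thms)
  then have "t = 16 * (y\<^sup>2 * z\<^sup>2)"
    by (simp add: yz)
  then have t: "t = (4 * (y * z))\<^sup>2"
    by (simp only: sixteen power_mult_distrib)
  have "t \<noteq> 0"
    using assms by (auto simp: quad_0)
  then have "4 * (y * z) \<noteq> 0"
    using t by auto
  then have "\<phi> t = 1"
    unfolding t by (rule quad_square)
  then show False
    using assms by simp
qed

text \<open>The equation splits into the disjoint branches \<open>y z = e\<close> and
  \<open>y z = - e\<close> with \<open>e = s / 4\<close>, whose discriminants \<open>1 - 4 e\<close>
  and \<open>1 + 4 e\<close> are \<open>1 - s\<close> and \<open>1 + s\<close>.\<close>

lemma card_quarter_square: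
  fixes s :: "'p mod_ring"
  assumes "s \<noteq> 0"
  shows "of_nat (card {(y, z). y\<^sup>2 * z\<^sup>2 = s\<^sup>2 / 16}) = 2 * (of_nat CARD('p) - 1 :: complex)" (is ?th1)
    and "of_nat (card {(y, z). y\<^sup>2 * z\<^sup>2 = s\<^sup>2 / 16 \<and> 1 + y + z = 0}) = 2 + \<phi> (1 + s) + \<phi> (1 - s)" (is ?th2)
proof -
  define e where "e = s / 4"
  have "e \<noteq> 0" using assms by (simp add: e_def)
  have "e \<noteq> - e"
    using \<open>e \<noteq> 0\<close> by (simp add: eq_neg_iff_add_eq_0 flip: mult_2)
  have "s\<^sup>2 / 16 = e\<^sup>2"
    by (simp add: e_def power_divide)
  then have iff: "y\<^sup>2 * z\<^sup>2 = s\<^sup>2 / 16 \<longleftrightarrow> y * z = e \<or> y * z = - e" for y z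
    by (simp only: power_mult_distrib[symmetric] power2_eq_iff)
  have "{(y, z). y\<^sup>2 * z\<^sup>2 = s\<^sup>2 / 16} = {(y, z). y * z ^ 1 = e} \<union> {(y, z). y * z ^ 1 = - e}"
    unfolding iff by auto
  moreover have "{(y, z). y * z ^ 1 = e} \<inter> {(y, z). y * z ^ 1 = - e} = {}"
    using \<open>e \<noteq> - e\<close> by auto
  ultimately have "card {(y, z). y\<^sup>2 * z\<^sup>2 = s\<^sup>2 / 16} =
      card {(y, z). y * z ^ 1 = e} + card {(y, z). y * z ^ 1 = - e}"
    by (simp only: card_Un_disjoint finite_code)
  then show ?th1
    using card_mult_eq[of e 1] card_mult_eq[of "- e" 1] \<open>e \<noteq> 0\<close> by simp
  have "{(y, z). y\<^sup>2 * z\<^sup>2 = s\<^sup>2 / 16 \<and> 1 + y + z = 0} =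
      {(y, z). y * z = e \<and> 1 + y + z = 0} \<union> {(y, z). y * z = - e \<and> 1 + y + z = 0}"
    unfolding iff by auto
  moreover have "{(y, z). y * z = e \<and> 1 + y + z = 0} \<inter> {(y, z). y * z = - e \<and> 1 + y + z = 0} = {}"
    using \<open>e \<noteq> - e\<close> by auto
  ultimately have "card {(y, z). y\<^sup>2 * z\<^sup>2 = s\<^sup>2 / 16 \<and> 1 + y + z = 0} =
      card {(y, z). y * z = e \<and> 1 + y + z = 0} + card {(y, z). y * z = - e \<and> 1 + y + z = 0}"
    by (simp only: card_Un_disjoint finite_code)
  then show ?th2
    using card_sum_prod_eq[of e] card_sum_prod_eq[of "- e"] by (simp add: e_def)
qed

text \<open>The correction now lives at \<open>k = 0\<close> and \<open>k = half\<close>, where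
  every Gauss sum in the summand is \<open>- 1\<close>; together they contribute
  \<open>- 1 - \<phi> t\<close>, the source of the last term.\<close>

lemma hyp_H_quarter:
  assumes "t \<noteq> 0"
  shows "hyp_H \<zeta> \<omega> {#1/4, 3/4#} {#1, 1/2#} t =
    of_nat (card {(y, z). y\<^sup>2 * z\<^sup>2 = t / 16 \<and> 1 + y + z = 0}) -
    of_nat (card {(y, z). y\<^sup>2 * z\<^sup>2 = t / 16}) / of_nat CARD('p) - (1 + \<phi> t) / of_nat CARD('p)"
proof -
  let ?q = "of_nat CARD('p) :: complex"
  define d where "d = t / 16"
  define T where "T k = G (4 * k) * G (- 2 * k) * G (- 2 * k) * ch k d" for k
  have sixteen: "(16 :: 'p mod_ring) = 4\<^sup>2" by simp
  have "(16 :: 'p mod_ring) \<noteq> 0"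
    unfolding sixteen by (simp only: power_eq_0_iff four_neq_0 simp_thms)
  then have "d \<noteq> 0" using assms by (simp add: d_def)
  have "\<phi> t = \<phi> (d * 4\<^sup>2)"
    using \<open>(16 :: 'p mod_ring) \<noteq> 0\<close> by (simp add: d_def)
  then have quad_d: "\<phi> d = \<phi> t"
    by (simp only: quad_mult quad_square[OF four_neq_0] mult_1_right)
  have norm: "(- 1) ^ sum_mset {#2, 2#} * inverse (exponents_norm {#4#} {#2, 2#}) * t = d"
  proof -
    \<comment> \<open>\<open>N = 4^4 / (2^2 2^2)\<close>, with \<open>4^4\<close> written as
      \<open>16 * 16\<close> to cancel in the field.\<close>
    have "exponents_norm {#4#} {#2, 2#} = (16 * 16 / 16 :: 'p mod_ring)"
      by (simp add: exponents_norm_def)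
    also have "\<dots> = 16"
      by (rule nonzero_mult_div_cancel_right) fact
    finally have norm: "exponents_norm {#4#} {#2, 2#} = (16 :: 'p mod_ring)" .
    have "(- 1) ^ sum_mset {#2, 2#} = (1 :: 'p mod_ring)"
      by simp
    then show ?thesis
      by (simp only: norm d_def mult_1_left divide_inverse mult.commute)
  qed
  have "hyp_H \<zeta> \<omega> {#1/4, 3/4#} {#1, 1/2#} t =
      - (\<Sum>k = 0..int CARD('p) - 2. ?q powi (- 1 + of_bool (k \<in> {0, half})) * T k) / (1 - ?q)"
  proof -
    have "(\<Sum>k = 0..int CARD('p) - 2.
      ?q powi (- int (gcd_mult CARD('p) {#4#} {#2, 2#} 0) + int (gcd_mult CARD('p) {#4#} {#2, 2#} k)) *
      (\<Prod>u\<in>#{#4#}. G (int u * k)) * (\<Prod>v\<in>#{#2, 2#}. G (- int v * k)) * ch k d) =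
      (\<Sum>k = 0..int CARD('p) - 2. ?q powi (- 1 + of_bool (k \<in> {0, half})) * T k)"
    proof (intro sum.cong refl)
      fix k assume "k \<in> {0..int CARD('p) - 2}"
      then have "period dvd 2 * k \<longleftrightarrow> k \<in> {0, half}"
        by (simp only: period_dvd_range insert_iff empty_iff simp_thms)
      then show "?q powi (- int (gcd_mult CARD('p) {#4#} {#2, 2#} 0) + int (gcd_mult CARD('p) {#4#} {#2, 2#} k)) *
        (\<Prod>u\<in>#{#4#}. G (int u * k)) * (\<Prod>v\<in>#{#2, 2#}. G (- int v * k)) * ch k d =
        ?q powi (- 1 + of_bool (k \<in> {0, half})) * T k"
        unfolding gcd_mult_quarter by (simp add: T_def mult_ac)
    qed
    then show ?thesis
      unfolding hyp_H_eq[OF exponents_quarter] norm by simp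
  qed
  also have "(\<Sum>k = 0..int CARD('p) - 2. ?q powi (- 1 + of_bool (k \<in> {0, half})) * T k) =
      (\<Sum>k = 0..int CARD('p) - 2. T k) / ?q + (1 - 1 / ?q) * (\<Sum>k\<in>{0, half}. T k)"
    by (rule weighted_sum) (use zero_in_range half_in_range in blast)
  also have "(\<Sum>k\<in>{0, half}. T k) = - 1 - \<phi> t"
  proof -
    have "T half = - \<phi> t"
      by (simp add: T_def G_trivial period_eq ch_half quad_d)
    moreover have "T 0 = - 1"
      using \<open>d \<noteq> 0\<close> by (simp add: T_def G_trivial ch_0)
    ultimately show ?thesis
      using half_pos by simp
  qed
  also have "(\<Sum>k = 0..int CARD('p) - 2. T k) =
      (?q - 1) * (?q * of_nat (card {(y, z). y\<^sup>2 * z\<^sup>2 = d \<and> 1 + y + z = 0}) -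
        of_nat (card {(y, z). y\<^sup>2 * z\<^sup>2 = d}))"
    using triple_sum[of 2 2 d] \<open>d \<noteq> 0\<close> by (simp add: T_def of_period)
  finally have H: "hyp_H \<zeta> \<omega> {#1/4, 3/4#} {#1, 1/2#} t = - ((?q - 1) *
      (?q * of_nat (card {(y, z). y\<^sup>2 * z\<^sup>2 = d \<and> 1 + y + z = 0}) -
        of_nat (card {(y, z). y\<^sup>2 * z\<^sup>2 = d})) / ?q + (1 - 1 / ?q) * (- 1 - \<phi> t)) / (1 - ?q)" .
  have "- ((q - 1) * (q * a - b) / q + (1 - 1 / q) * (- 1 - c)) / (1 - q) = a - b / q - (1 + c) / q"
    if "q \<noteq> 0" "q \<noteq> 1" for q a b c :: complex
  proof -
    have "(q - 1) * (q * a - b) / q + (1 - 1 / q) * (- 1 - c) = (q - 1) * (a - b / q - (1 + c) / q)"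
      using that(1) by (simp add: field_simps)
    then show ?thesis
      by (simp only: cancel_factor[OF that(2)])
  qed
  from this[OF q_neq_0 q_neq_1] show ?thesis
    unfolding H by (simp only: d_def)
qed

section \<open>The parameters 1/6 and 5/6\<close>

definition sixth_term :: "'p mod_ring \<Rightarrow> int \<Rightarrow> complex" where
  "sixth_term e k = of_nat CARD('p) powi (- 2 + (of_bool (period dvd 2 * k) + of_bool (period dvd 3 * k))) *
    (G (6 * k) * G k) * (G (- 2 * k) * (G (- 2 * k) * G (- 3 * k))) * ch k e"

text \<open>Treats trivial and nontrivial characters by one power of \<open>p\<close>, so that
  exponents can simply be added later.\<close>

lemma G_mult_G_minus_powi:
  "G k * G (- k) = ch k (- 1) * of_nat CARD('p) powi (1 - of_bool (period dvd k))"
proof (cases "period dvd k")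
  case True
  then show ?thesis
    by (simp add: G_mult_G_minus ch_trivial of_period)
next
  case False
  then show ?thesis
    by (simp add: G_mult_G_minus)
qed

lemma not_period_dvd_half: "\<not> period dvd half"
  using half_pos zdvd_not_zless[of half period] by (simp add: period_eq)

lemma G_half_square: "G half * G half = \<phi> (- 1) * of_nat CARD('p)"
proof -
  have "G half = G (- half)"
    by (rule G_cong) (simp add: period_eq)
  then show ?thesis
    using G_mult_G_minus_powi[of half] not_period_dvd_half by (simp add: ch_half)
qed

text \<open>Duplication at \<open>3 * k\<close> and at \<open>- k\<close> makes
  \<open>G (3 * k) * G (- 3 * k)\<close> and \<open>G k * G (- k)\<close> appear, which collapse to
  signs and powers of \<open>p\<close>. The surviving \<open>u\<close>, \<open>v\<close>,
  \<open>w\<close> are the Gauss sums of \<open>third_term\<close> at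
  \<open>k + half\<close>.\<close>

lemma sixth_term_eq:
  assumes "CARD('p) > 3" "t \<noteq> 0"
  shows "sixth_term (- t / 108) k = \<phi> (t / 3) * third_term (- 4 * t / 27) (k + half)"
proof -
  let ?q = "of_nat CARD('p) :: complex"
  define g where "g = G half"
  define u where "u = G (3 * k + half)"
  define v where "v = G (- k + half)"
  define w where "w = G (- 2 * k)"
  define c where "c = ch k 4"
  define s1 s2 s3 :: int where "s1 = of_bool (period dvd k)"
    and "s2 = of_bool (period dvd 2 * k)" and "s3 = of_bool (period dvd 3 * k)"
  have nz3: "(3 :: 'p mod_ring) \<noteq> 0"
    using assms(1) by (rule three_neq_0)
  have "(3 :: 'p mod_ring) ^ 3 \<noteq> 0" "(3 :: 'p mod_ring) ^ 3 * 4 \<noteq> 0"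
    using nz3 four_neq_0 by (simp_all only: power_eq_0_iff mult_eq_0_iff simp_thms)
  then have nz: "(27 :: 'p mod_ring) \<noteq> 0" "(108 :: 'p mod_ring) \<noteq> 0"
    by simp_all
  have c: "c \<noteq> 0" "ch (- k) 4 = inverse c"
    by (simp_all add: c_def ch_eq_0_iff ch_minus)
  have "ch (int 3 * k) 4 = ch k (4 ^ 3)"
    by (rule ch_power) simp
  then have c3: "ch (3 * k) 4 = c ^ 3"
    by (simp only: power3_eq_cube ch_mult c_def of_nat_numeral)
  have g2: "g * g = \<phi> (- 1) * ?q"
    by (simp add: g_def G_half_square)
  then have "g \<noteq> 0"
    using q_neq_0 quad_mult_self[of "- 1"] by auto
  have "G (3 * k) * u * c ^ 3 = g * G (6 * k)"
    using G_duplication[of "3 * k"] by (simp add: u_def g_def c3)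
  then have G6: "G (6 * k) = G (3 * k) * u * c ^ 3 / g"
    using \<open>g \<noteq> 0\<close> by simp
  have "G (- k) * v * inverse c = g * w"
    using G_duplication[of "- k"] by (simp add: v_def w_def g_def c)
  then have w: "w = G (- k) * v * inverse c / g"
    using \<open>g \<noteq> 0\<close> by simp
  have pm3: "G (3 * k) * G (- 3 * k) = ch k (- 1) * ?q powi (1 - s3)"
    using G_mult_G_minus_powi[of "3 * k"] ch_power[of 3 k "- 1"] by (simp add: s3_def)
  have pm1: "G k * G (- k) = ch k (- 1) * ?q powi (1 - s1)"
    using G_mult_G_minus_powi[of k] by (simp add: s1_def)
  have sgn: "ch k (- 1) * ch k (- 1) = 1"
    by (simp flip: ch_mult)
  have "sixth_term (- t / 108) k =
      ?q powi (- 2 + (s2 + s3)) * (G (6 * k) * G k) * (w * (w * G (- 3 * k))) * ch k (- t / 108)"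
    by (simp only: sixth_term_def w_def s2_def s3_def)
  also have "\<dots> = ?q powi (- 2 + (s2 + s3)) * (G (3 * k) * u * c ^ 3 / g * G k) *
      (G (- k) * v * inverse c / g * (w * G (- 3 * k))) * ch k (- t / 108)"
    \<comment> \<open>Only one of the two factors \<open>w\<close> is expanded; the other survives
      as \<open>G (- 2 * (k + half))\<close>.\<close>
    by (simp only: G6) (simp only: w[symmetric])
  also have "\<dots> = ?q powi (- 2 + (s2 + s3)) * (G (3 * k) * G (- 3 * k)) * (G k * G (- k)) *
      (u * v * w) / (g * g) * (c * c * ch k (- t / 108))"
    using \<open>c \<noteq> 0\<close> by (simp add: power3_eq_cube field_simps)
  \<comment> \<open>\<open>c ^ 3\<close> from \<open>G (6 * k)\<close> and \<open>inverse c\<close>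
    from \<open>w\<close> leave \<open>c * c = ch k 16\<close>.\<close>
  also have "c * c * ch k (- t / 108) = ch k (- 4 * t / 27)"
  proof -
    have "4 * 4 * (- t / 108) = - 4 * t / (27 :: 'p mod_ring)"
      using nz by (simp add: field_simps)
    then show ?thesis
      by (simp only: c_def ch_mult[symmetric])
  qed
  \<comment> \<open>The signs \<open>ch k (- 1)\<close> cancel in pairs, and the exponents
    \<open>- 2 + s2 + s3\<close>, \<open>1 - s3\<close>, \<open>1 - s1\<close> add up to
    \<open>s2 - s1\<close>.\<close>
  also have "?q powi (- 2 + (s2 + s3)) * (G (3 * k) * G (- 3 * k)) * (G k * G (- k)) =
      ?q powi (s2 - s1)"
  proof -
    have "?q powi (- 2 + (s2 + s3)) * (G (3 * k) * G (- 3 * k)) * (G k * G (- k)) =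
        (ch k (- 1) * ch k (- 1)) * (?q powi (- 2 + (s2 + s3)) * ?q powi (1 - s3) * ?q powi (1 - s1))"
      unfolding pm3 pm1 by (simp only: mult_ac)
    also have "\<dots> = ?q powi (s2 - s1)"
      unfolding sgn using q_neq_0 by (simp flip: power_int_add)
    finally show ?thesis .
  qed
  also have "?q powi (s2 - s1) * (u * v * w) / (g * g) =
      \<phi> (- 1) * (?q powi (- 1 + (s2 - s1)) * (u * v * w))"
  proof -
    have "inverse (\<phi> (- 1)) = \<phi> (- 1)"
      by (rule inverse_unique) (simp add: quad_mult_self)
    moreover have "?q powi (- 1 + (s2 - s1)) = inverse ?q * ?q powi (s2 - s1)"
      using q_neq_0 by (simp only: power_int_add power_int_minus power_int_1_right simp_thms)
    ultimately show ?thesis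
      by (simp only: g2 divide_inverse inverse_mult_distrib mult_ac)
  qed
  finally have lhs: "sixth_term (- t / 108) k =
      \<phi> (- 1) * (?q powi (- 1 + (s2 - s1)) * (u * v * w)) * ch k (- 4 * t / 27)" .

  have "s2 - s1 = of_bool (period dvd k + half)"
    by (auto simp: s1_def s2_def period_dvd_shift)
  moreover have "G (3 * (k + half)) = u"
    unfolding u_def by (rule G_cong) (simp add: period_eq)
  moreover have "G (- (k + half)) = v"
    unfolding v_def by (rule G_cong) (simp add: period_eq)
  moreover have "G (- 2 * (k + half)) = w"
    unfolding w_def by (rule G_cong) (simp add: period_eq)
  ultimately have rhs: "third_term (- 4 * t / 27) (k + half) =
      ?q powi (- 1 + (s2 - s1)) * (u * v * w) * (ch k (- 4 * t / 27) * \<phi> (- 4 * t / 27))"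
    by (simp only: third_term_def ch_add ch_half mult.assoc)

  \<comment> \<open>The product of the arguments is \<open>- 1\<close> times a nonzero square, so
    this factor is the \<open>\<phi> (- 1)\<close> left over from \<open>g * g\<close>.\<close>
  have "\<phi> (t / 3) * \<phi> (- 4 * t / 27) = \<phi> (- 1)"
  proof -
    have "t / 3 * (- 4 * t / 27) = - 1 * (2 * t / 9)\<^sup>2"
      by (simp add: power2_eq_square)
    moreover have "(3 :: 'p mod_ring)\<^sup>2 \<noteq> 0"
      using nz3 by (simp only: power_eq_0_iff simp_thms)
    then have "2 * t / (9 :: 'p mod_ring) \<noteq> 0"
      using assms(2) by simp
    ultimately show ?thesis
      by (metis quad_mult quad_square mult_1_right)
  qed
  then show ?thesis
    unfolding lhs rhs by (simp add: mult_ac)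
qed

lemma hyp_H_sixth:
  assumes "CARD('p) > 3" "t \<noteq> 0"
  shows "hyp_H \<zeta> \<omega> {#1/6, 5/6#} {#1, 1/2#} t = \<phi> (t / 3) * hyp_H \<zeta> \<omega> {#1/3, 2/3#} {#1, 1/2#} t"
proof -
  have "(3 :: 'p mod_ring) ^ 3 * (4 * 4) \<noteq> 0"
    using three_neq_0[OF assms(1)] four_neq_0 by (simp only: power_eq_0_iff mult_eq_0_iff simp_thms)
  then have nz: "(432 :: 'p mod_ring) \<noteq> 0"
    by simp
  have norm: "(- 1) ^ sum_mset {#2, 2, 3#} * inverse (exponents_norm {#6, 1#} {#2, 2, 3#}) * t = - t / 108"
  proof -
    \<comment> \<open>Here \<open>6^6 = 108 * 432\<close> and
      \<open>2^2 2^2 3^3 = 432\<close>.\<close>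
    have "exponents_norm {#6, 1#} {#2, 2, 3#} = (108 * 432 / 432 :: 'p mod_ring)"
      by (simp add: exponents_norm_def)
    also have "\<dots> = 108"
      by (rule nonzero_mult_div_cancel_right) fact
    finally have "exponents_norm {#6, 1#} {#2, 2, 3#} = (108 :: 'p mod_ring)" .
    moreover have "(- 1) ^ sum_mset {#2, 2, 3#} = (- 1 :: 'p mod_ring)"
      by simp
    ultimately show ?thesis
      by (simp only: divide_inverse) (simp add: mult.commute)
  qed
  have "hyp_H \<zeta> \<omega> {#1/6, 5/6#} {#1, 1/2#} t =
      - (\<Sum>k = 0..int CARD('p) - 2. sixth_term (- t / 108) k) / (1 - of_nat CARD('p))"
    unfolding hyp_H_eq[OF exponents_sixth] gcd_mult_sixth norm
    by (simp add: sixth_term_def)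
  also have "(\<Sum>k = 0..int CARD('p) - 2. sixth_term (- t / 108) k) =
      \<phi> (t / 3) * (\<Sum>k = 0..int CARD('p) - 2. third_term (- 4 * t / 27) (k + half))"
    by (simp only: sixth_term_eq[OF assms] sum_distrib_left)
  also have "(\<Sum>k = 0..int CARD('p) - 2. third_term (- 4 * t / 27) (k + half)) =
      (\<Sum>k = 0..int CARD('p) - 2. third_term (- 4 * t / 27) k)"
    by (rule sum_shift) (rule third_term_cong)
  finally show ?thesis
    unfolding hyp_H_third_term[OF assms(1)] by simp
qed

lemma hyp_H_quarter_nonsquare:
  assumes "\<phi> t = - 1"
  shows "hyp_H \<zeta> \<omega> {#1/4, 3/4#} {#1, 1/2#} t = 0"
proof -
  have "t \<noteq> 0"
    using assms by (auto simp: quad_0)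
  have "{(y, z). y\<^sup>2 * z\<^sup>2 = t / 16 \<and> 1 + y + z = 0} = {}"
    using card_quarter_nonsquare[OF assms] by blast
  then show ?thesis
    by (simp only: hyp_H_quarter[OF \<open>t \<noteq> 0\<close>] card_quarter_nonsquare[OF assms] assms) simp
qed

text \<open>The constant terms cancel: \<open>2 - 2 (q - 1) / q - 2 / q = 0\<close> for
  \<open>q = p\<close>.\<close>

lemma hyp_H_quarter_square:
  assumes "s \<noteq> 0"
  shows "hyp_H \<zeta> \<omega> {#1/4, 3/4#} {#1, 1/2#} (s\<^sup>2) = \<phi> (1 + s) + \<phi> (1 - s)"
proof -
  have "s\<^sup>2 \<noteq> 0"
    using assms by simp
  then show ?thesis
    unfolding hyp_H_quarter[OF \<open>s\<^sup>2 \<noteq> 0\<close>] card_quarter_square[OF assms] quad_square[OF assms]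
    using q_neq_0 by (simp add: field_simps)
qed

end

theorem theorem1p4:
  fixes \<zeta> :: complex
    and \<omega> :: "'p::prime_card mod_ring \<Rightarrow> complex"
    and t :: "'p mod_ring"
  assumes "odd CARD('p)"
    and "CARD('p) > 3"
    and "primitive_root_unity CARD('p) \<zeta>"
    and "generates_characters \<omega>"
    and "t \<noteq> 0"
  shows
    "(\<not> CARD('p) dvd common_denom {#1/4, 3/4#} {#1, 1/2#} \<longrightarrow>
        (\<forall>s. quad_char t = 1 \<and> s^2 = t \<longrightarrow>
           hyp_H \<zeta> \<omega> {#1/4, 3/4#} {#1, 1/2#} t =
             (1 + quad_char t) / 2 * (quad_char (1 + s) + quad_char (1 - s))) \<and>
        (quad_char t = -1 \<longrightarrow> hyp_H \<zeta> \<omega> {#1/4, 3/4#} {#1, 1/2#} t = 0) \<and>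
        hyp_H \<zeta> \<omega> {#1/4, 3/4#} {#1, 1/2#} 1 = quad_char (2 :: 'p mod_ring)) \<and>
     (\<not> CARD('p) dvd common_denom {#1/3, 2/3#} {#1, 1/2#} \<longrightarrow>
        hyp_H \<zeta> \<omega> {#1/3, 2/3#} {#1, 1/2#} t = of_nat (zeros_distinct (cubic t)) - 1 \<and>
        (t \<noteq> 1 \<longrightarrow>
           hyp_H \<zeta> \<omega> {#1/3, 2/3#} {#1, 1/2#} t = of_nat (zeros_with_mult (cubic t)) - 1) \<and>
        hyp_H \<zeta> \<omega> {#1/3, 2/3#} {#1, 1/2#} 1 = 1) \<and>
     (\<not> CARD('p) dvd common_denom {#1/6, 5/6#} {#1, 1/2#} \<longrightarrow>
        hyp_H \<zeta> \<omega> {#1/6, 5/6#} {#1, 1/2#} t =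
          quad_char (t / 3) * (of_nat (zeros_distinct (cubic t)) - 1) \<and>
        (t \<noteq> 1 \<longrightarrow>
           hyp_H \<zeta> \<omega> {#1/6, 5/6#} {#1, 1/2#} t =
             quad_char (t / 3) * (of_nat (zeros_with_mult (cubic t)) - 1)) \<and>
        hyp_H \<zeta> \<omega> {#1/6, 5/6#} {#1, 1/2#} 1 = quad_char (3 :: 'p mod_ring))"
proof -
  interpret character_setup \<zeta> \<omega>
    using assms by unfold_locales
  have quarter: "hyp_H \<zeta> \<omega> {#1/4, 3/4#} {#1, 1/2#} t =
      (1 + quad_char t) / 2 * (quad_char (1 + s) + quad_char (1 - s))"
    if "quad_char t = 1" "s\<^sup>2 = t" for s
    using hyp_H_quarter_square[of s] that assms(5) by auto
  have quarter_1: "hyp_H \<zeta> \<omega> {#1/4, 3/4#} {#1, 1/2#} 1 = quad_char (2 :: 'p mod_ring)"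
    \<comment> \<open>For \<open>s = 1\<close> the second summand is
      \<open>\<phi> 0 = 0\<close>.\<close>
    using hyp_H_quarter_square[of 1] by (simp add: quad_0)
  have third: "hyp_H \<zeta> \<omega> {#1/3, 2/3#} {#1, 1/2#} x = of_nat (zeros_distinct (cubic x)) - 1"
    if "x \<noteq> 0" for x
    using assms(2) that by (rule hyp_H_third)
  have third_1: "hyp_H \<zeta> \<omega> {#1/3, 2/3#} {#1, 1/2#} 1 = 1"
    using third[of 1] zeros_distinct_cubic_1[OF assms(2) two_neq_0] by simp
  have sixth: "hyp_H \<zeta> \<omega> {#1/6, 5/6#} {#1, 1/2#} x =
      quad_char (x / 3) * hyp_H \<zeta> \<omega> {#1/3, 2/3#} {#1, 1/2#} x" if "x \<noteq> 0" for x
    using assms(2) that by (rule hyp_H_sixth)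
  have sixth_1: "hyp_H \<zeta> \<omega> {#1/6, 5/6#} {#1, 1/2#} 1 = quad_char (3 :: 'p mod_ring)"
    using sixth[of 1] third_1 quad_inverse[of 3] by (simp add: inverse_eq_divide)
  show ?thesis
    using quarter quarter_1 hyp_H_quarter_nonsquare[of t] third[OF assms(5)] third_1
      sixth[OF assms(5)] sixth_1 zeros_with_mult_cubic[OF assms(2,1), of t]
    by auto
qed

end
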